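(* Let $X$ be a quasi-symmetric linear representation of a split reductive group $G$ with maximal torus $T$, and suppose the generic stabilizer of $T$ on $X$ is finite. Then the chambers of $M_{\mathbb R}\cong\mathrm{NS}^T(X)_{\mathbb R}$ arising from GIT for $X/T$ are exactly the connected components of the complement $M_{\mathbb R}\setminus\bigcup_\alpha H_\alpha$ of the linear hyperplane arrangement $\mathcal A=\{H_\alpha\}$ consisting of the linear subspaces of $M_{\mathbb R}$ parallel to the codimension $1$ faces of $\overline\Sigma$.
   Context: $k$ is a field of characteristic $0$, $M$ is the character lattice of $T$, $M_{\mathbb R}=M\otimes\mathbb R$, and $\beta_1,\dots,\beta_d\in M$ are the $T$-weights of $X^\vee$ with multiplicity. $X$ is quasi-symmetric if $\sum_{\beta_i\in L}\beta_i=0$ for every line $L\subset M_{\mathbb R}$ through the origin. $\overline\Sigma=\{\sum_i a_i\beta_i : a_i\in[-1,0]\}\subset M_{\mathbb R}$; the finiteness of the generic $T$-stabilizer is equivalent to $\overline\Sigma$ linearly spanning $M_{\mathbb R}$. For $\ell\in M_{\mathbb R}$, $X^{T\text{-ss}}(\ell)\subset X$ is the open set of points $x$ such that $\langle\lambda,\ell\rangle\le0$ for every cocharacter $\lambda\colon\mathbb G_m\to T$ for which $\lim_{t\to0}\lambda(t)\cdot x$ exists; $X^{T\text{-ss}}(\ell)=X^{T\text{-s}}(\ell)$ means every point of $X^{T\text{-ss}}(\ell)$ has finite stabilizer in $T$. The chambers arising from GIT (Dolgachev–Hu) are the connected components of the set $\{\ell\in M_{\mathbb R} : X^{T\text{-ss}}(\ell)=X^{T\text{-s}}(\ell)\}$;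 $X^{T\text{-ss}}(\ell)$ is constant for $\ell$ in each chamber. *)

theory Defs
  imports
    "HOL-Analysis.Analysis"
    "HOL-Computational_Algebra.Polynomial"
    "HOL-Library.Function_Algebras"
begin

section \<open>Linear algebraic groups over a field of characteristic zero\<close>

text \<open>
  Varieties over the ground field \<open>k\<close> are represented by their \<open>k\<close>-points, together with the
  algebra of regular functions, which is generated by explicit coordinate functions.  As \<open>k\<close> is
  infinite and perfect, a torus, a connected linear algebraic group and a linear representation have
  dense sets of \<open>k\<close>-points, so regular functions and morphisms are determined by their values there.
\<close>

inductive_set alg_gen :: "('p \<Rightarrow> 'k::field) set \<Rightarrow> ('p \<Rightarrow> 'k) set" for F where
  gen: "f \<in> F \<Longrightarrow> f \<in> alg_gen F"
| const: "(\<lambda>_. c) \<in> alg_gen F"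
| add: "f \<in> alg_gen F \<Longrightarrow> g \<in> alg_gen F \<Longrightarrow> (\<lambda>p. f p + g p) \<in> alg_gen F"
| mult: "f \<in> alg_gen F \<Longrightarrow> g \<in> alg_gen F \<Longrightarrow> (\<lambda>p. f p * g p) \<in> alg_gen F"

definition GL :: "('k::field^'m^'m) set" where
  "GL = {g. invertible g}"

definition regular_GL :: "('k::field^'m^'m \<Rightarrow> 'k) set" where
  "regular_GL = alg_gen ({\<lambda>g. g $ i $ j | i j. True} \<union> {\<lambda>g. inverse (det g)})"

definition regular_Gm :: "('k::field \<Rightarrow> 'k) set" where
  "regular_Gm = alg_gen {\<lambda>t. t, \<lambda>t. inverse t}"

definition closed_GL :: "('k::field^'m^'m) set \<Rightarrow> bool" where
  "closed_GL S \<longleftrightarrow> (\<exists>P \<subseteq> regular_GL. S = {g \<in> GL. \<forall>p\<in>P. p g = 0})"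

definition regular_on :: "('k::field^'m^'m) set \<Rightarrow> ('k^'m^'m \<Rightarrow> 'k) \<Rightarrow> bool" where
  "regular_on S f \<longleftrightarrow> (\<exists>p \<in> regular_GL. \<forall>g\<in>S. f g = p g)"

definition zariski_connected :: "('k::field^'m^'m) set \<Rightarrow> bool" where
  "zariski_connected S \<longleftrightarrow>
     \<not> (\<exists>A B. closed_GL A \<and> closed_GL B \<and> A \<noteq> {} \<and> B \<noteq> {} \<and> A \<inter> B = {} \<and> A \<union> B = S)"

definition algebraic_group :: "('k::field^'m^'m) set \<Rightarrow> bool" where
  "algebraic_group G \<longleftrightarrow> closed_GL G \<and> mat 1 \<in> G \<and>
     (\<forall>g\<in>G. \<forall>h\<in>G. g ** h \<in> G) \<and> (\<forall>g\<in>G. matrix_inv g \<in> G)"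

definition mat_pow :: "'k::field^'m^'m \<Rightarrow> nat \<Rightarrow> 'k^'m^'m" where
  "mat_pow A n = (((**) A) ^^ n) (mat 1)"

definition mat_poly :: "'k::field poly \<Rightarrow> 'k^'m^'m \<Rightarrow> 'k^'m^'m" where
  "mat_poly p A = (\<Sum>i\<le>degree p. (\<chi> a b. coeff p i * mat_pow A i $ a $ b))"

definition unipotent_mat :: "'k::field^'m^'m \<Rightarrow> bool" where
  "unipotent_mat g \<longleftrightarrow> (\<exists>n. mat_pow (g - mat 1) n = 0)"

text \<open>Annihilated by a separable polynomial, i.e. diagonalizable over an algebraic closure.\<close>

definition semisimple_mat :: "'k::field^'m^'m \<Rightarrow> bool" where
  "semisimple_mat g \<longleftrightarrow> (\<exists>p. p \<noteq> 0 \<and> coprime p (pderiv p) \<and> mat_poly p g = 0)"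

text \<open>
  Trivial unipotent radical.  In characteristic zero unipotent groups are automatically connected and
  the unipotent radical is defined over the ground field, so it suffices to consider closed normal
  unipotent subgroups on the level of \<open>k\<close>-points.  Connectedness of \<open>G\<close> is not imposed.
\<close>

definition reductive_group :: "('k::field_char_0^'m^'m) set \<Rightarrow> bool" where
  "reductive_group G \<longleftrightarrow> algebraic_group G \<and>
     (\<forall>U \<subseteq> G. algebraic_group U \<and> (\<forall>u\<in>U. unipotent_mat u) \<and>
        (\<forall>g\<in>G. \<forall>u\<in>U. g ** u ** matrix_inv g \<in> U) \<longrightarrow> U = {mat 1})"

text \<open>A torus that need not be split.\<close>

definition torus :: "('k::field_char_0^'m^'m) set \<Rightarrow> bool" where
  "torus S \<longleftrightarrow> algebraic_group S \<and> zariski_connected S \<and>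
     (\<forall>g\<in>S. \<forall>h\<in>S. g ** h = h ** g) \<and> (\<forall>g\<in>S. semisimple_mat g)"

definition maximal_torus :: "('k::field_char_0^'m^'m) set \<Rightarrow> ('k^'m^'m) set \<Rightarrow> bool" where
  "maximal_torus G T \<longleftrightarrow> torus T \<and> T \<subseteq> G \<and> (\<forall>S. torus S \<and> T \<subseteq> S \<and> S \<subseteq> G \<longrightarrow> S = T)"

definition Gm_power :: "nat \<Rightarrow> (nat \<Rightarrow> 'k::field) set" where
  "Gm_power r = {..<r} \<rightarrow>\<^sub>E (UNIV - {0})"

definition regular_Gm_power :: "nat \<Rightarrow> ((nat \<Rightarrow> 'k::field) \<Rightarrow> 'k) set" where
  "regular_Gm_power r =
     alg_gen ({\<lambda>t. t i | i. i < r} \<union> {\<lambda>t. inverse (t i) | i. i < r})"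

text \<open>Isomorphic, as an algebraic group, to a finite (possibly empty) power of the multiplicative group.\<close>

definition split_torus :: "('k::field^'m^'m) set \<Rightarrow> bool" where
  "split_torus T \<longleftrightarrow> algebraic_group T \<and>
     (\<exists>r \<theta>. bij_betw \<theta> (Gm_power r) T \<and>
        (\<forall>s\<in>Gm_power r. \<forall>t\<in>Gm_power r. \<theta> (\<lambda>i\<in>{..<r}. s i * t i) = \<theta> s ** \<theta> t) \<and>
        (\<forall>a b. \<exists>p \<in> regular_Gm_power r. \<forall>t\<in>Gm_power r. \<theta> t $ a $ b = p t) \<and>
        (\<forall>i<r. regular_on T (\<lambda>g. inv_into (Gm_power r) \<theta> g i)))"

definition split_reductive :: "('k::field_char_0^'m^'m) set \<Rightarrow> ('k^'m^'m) set \<Rightarrow> bool" where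
  "split_reductive G T \<longleftrightarrow> reductive_group G \<and> maximal_torus G T \<and> split_torus T"

section \<open>Linear representations\<close>

abbreviation functional :: "('k::field \<Rightarrow> 'x::ab_group_add \<Rightarrow> 'x) \<Rightarrow> ('x \<Rightarrow> 'k) \<Rightarrow> bool" where
  "functional sc \<phi> \<equiv> Vector_Spaces.linear sc (*) \<phi>"

definition linear_rep ::
  "('k::field \<Rightarrow> 'x::ab_group_add \<Rightarrow> 'x) \<Rightarrow> ('k^'m^'m) set \<Rightarrow> ('k^'m^'m \<Rightarrow> 'x \<Rightarrow> 'x) \<Rightarrow> bool" where
  "linear_rep sc G \<rho> \<longleftrightarrow>
     (\<forall>g\<in>G. Vector_Spaces.linear sc sc (\<rho> g)) \<and>
     \<rho> (mat 1) = id \<and> (\<forall>g\<in>G. \<forall>h\<in>G. \<rho> (g ** h) = \<rho> g \<circ> \<rho> h) \<and>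
     (\<forall>\<phi> x. functional sc \<phi> \<longrightarrow> regular_on G (\<lambda>g. \<phi> (\<rho> g x)))"

definition stabilizer :: "('k::field^'m^'m) set \<Rightarrow> ('k^'m^'m \<Rightarrow> 'x \<Rightarrow> 'x) \<Rightarrow> 'x \<Rightarrow> ('k^'m^'m) set" where
  "stabilizer T \<rho> x = {t\<in>T. \<rho> t x = x}"

text \<open>Finiteness on a nonempty Zariski open set; principal open sets form a basis.\<close>

definition generic_stabilizer_finite ::
  "('k::field \<Rightarrow> 'x::ab_group_add \<Rightarrow> 'x) \<Rightarrow> ('k^'m^'m) set \<Rightarrow> ('k^'m^'m \<Rightarrow> 'x \<Rightarrow> 'x) \<Rightarrow> bool" where
  "generic_stabilizer_finite sc T \<rho> \<longleftrightarrow>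
     (\<exists>f \<in> alg_gen {\<phi>. functional sc \<phi>}.
        (\<exists>x. f x \<noteq> 0) \<and> (\<forall>x. f x \<noteq> 0 \<longrightarrow> finite (stabilizer T \<rho> x)))"

section \<open>Characters, cocharacters and weights\<close>

text \<open>Extensionality makes a character determined by its values on \<open>T\<close>; the group law is pointwise.\<close>

definition characters :: "('k::field^'m^'m) set \<Rightarrow> ('k^'m^'m \<Rightarrow> 'k) set" where
  "characters T = {\<eta> \<in> extensional T. regular_on T \<eta> \<and>
     (\<forall>t\<in>T. \<eta> t \<noteq> 0) \<and> (\<forall>s\<in>T. \<forall>t\<in>T. \<eta> (s ** t) = \<eta> s * \<eta> t)}"

definition char_mult :: "('k::field^'m^'m) set \<Rightarrow> ('k^'m^'m \<Rightarrow> 'k) \<Rightarrow> ('k^'m^'m \<Rightarrow> 'k) \<Rightarrow> ('k^'m^'m \<Rightarrow> 'k)" where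
  "char_mult T \<eta> \<psi> = (\<lambda>t\<in>T. \<eta> t * \<psi> t)"

definition cocharacters :: "('k::field^'m^'m) set \<Rightarrow> ('k \<Rightarrow> 'k^'m^'m) set" where
  "cocharacters T = {\<gamma>. (\<forall>s. s \<noteq> 0 \<longrightarrow> \<gamma> s \<in> T) \<and>
     (\<forall>s s'. s \<noteq> 0 \<longrightarrow> s' \<noteq> 0 \<longrightarrow> \<gamma> (s * s') = \<gamma> s ** \<gamma> s') \<and>
     (\<forall>a b. \<exists>p \<in> regular_Gm. \<forall>s. s \<noteq> 0 \<longrightarrow> \<gamma> s $ a $ b = p s)}"

definition pairing :: "('k::field \<Rightarrow> 'k^'m^'m) \<Rightarrow> ('k^'m^'m \<Rightarrow> 'k) \<Rightarrow> int" where
  "pairing \<gamma> \<eta> = (THE n. \<forall>s. s \<noteq> 0 \<longrightarrow> \<eta> (\<gamma> s) = s powi n)"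

text \<open>
  \<open>(V, \<iota>)\<close> realizes the tensor product of the character lattice \<open>M\<close> with the reals: \<open>\<iota>\<close> is additive
  (from the multiplicatively written group \<open>M\<close>), \<open>V\<close> is the span of its image, and every additive
  function on \<open>M\<close> extends linearly.  \<open>V\<close> is a subspace of the ambient type rather than the whole
  type because Euclidean spaces have positive dimension, whereas \<open>T\<close> may be trivial.
\<close>

definition real_extension ::
  "('k::field^'m^'m) set \<Rightarrow> 'v::euclidean_space set \<Rightarrow> (('k^'m^'m \<Rightarrow> 'k) \<Rightarrow> 'v) \<Rightarrow> bool" where
  "real_extension T V \<iota> \<longleftrightarrow>
     (\<forall>\<eta>\<in>characters T. \<forall>\<psi>\<in>characters T. \<iota> (char_mult T \<eta> \<psi>) = \<iota> \<eta> + \<iota> \<psi>) \<and>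
     V = span (\<iota> ` characters T) \<and>
     (\<forall>f :: ('k^'m^'m \<Rightarrow> 'k) \<Rightarrow> real.
        (\<forall>\<eta>\<in>characters T. \<forall>\<psi>\<in>characters T. f (char_mult T \<eta> \<psi>) = f \<eta> + f \<psi>) \<longrightarrow>
        (\<exists>h :: 'v \<Rightarrow> real. linear h \<and> (\<forall>\<eta>\<in>characters T. h (\<iota> \<eta>) = f \<eta>)))"

text \<open>The real-linear extension of the pairing; it is unique on the span of \<open>\<iota> ` characters T\<close>.\<close>

definition real_pairing ::
  "('k::field^'m^'m) set \<Rightarrow> (('k^'m^'m \<Rightarrow> 'k) \<Rightarrow> 'v::euclidean_space) \<Rightarrow> ('k \<Rightarrow> 'k^'m^'m) \<Rightarrow> 'v \<Rightarrow> real" where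
  "real_pairing T \<iota> \<gamma> =
     (SOME h. linear h \<and> (\<forall>\<eta>\<in>characters T. h (\<iota> \<eta>) = of_int (pairing \<gamma> \<eta>)))"

definition dual_scale :: "'k::field \<Rightarrow> ('x \<Rightarrow> 'k) \<Rightarrow> ('x \<Rightarrow> 'k)" where
  "dual_scale c \<phi> = (\<lambda>x. c * \<phi> x)"

lemma vector_space_dual_scale: "vector_space dual_scale"
  by unfold_locales (auto simp: dual_scale_def fun_eq_iff algebra_simps)

text \<open>The \<open>\<eta>\<close>-weight space of the dual representation, with its contragredient action.\<close>

definition dual_weight_space ::
  "('k::field \<Rightarrow> 'x::ab_group_add \<Rightarrow> 'x) \<Rightarrow> ('k^'m^'m) set \<Rightarrow> ('k^'m^'m \<Rightarrow> 'x \<Rightarrow> 'x) \<Rightarrow>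
   ('k^'m^'m \<Rightarrow> 'k) \<Rightarrow> ('x \<Rightarrow> 'k) set" where
  "dual_weight_space sc T \<rho> \<eta> =
     {\<phi>. functional sc \<phi> \<and> (\<forall>t\<in>T. \<forall>x. \<phi> (\<rho> (matrix_inv t) x) = \<eta> t * \<phi> x)}"

definition dual_weight_mult ::
  "('k::field \<Rightarrow> 'x::ab_group_add \<Rightarrow> 'x) \<Rightarrow> ('k^'m^'m) set \<Rightarrow> ('k^'m^'m \<Rightarrow> 'x \<Rightarrow> 'x) \<Rightarrow>
   ('k^'m^'m \<Rightarrow> 'k) \<Rightarrow> nat" where
  "dual_weight_mult sc T \<rho> \<eta> = vector_space.dim dual_scale (dual_weight_space sc T \<rho> \<eta>)"

text \<open>
  Index set of the weights \<open>\<beta>\<^sub>1, \<dots>, \<beta>\<^sub>d\<close> of the dual representation with multiplicity: a weight \<open>\<eta>\<close>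
  occurs as \<open>(\<eta>, j)\<close> for every \<open>j\<close> below its multiplicity, so that \<open>\<beta>\<close> is the first projection.
\<close>

definition weight_index ::
  "('k::field \<Rightarrow> 'x::ab_group_add \<Rightarrow> 'x) \<Rightarrow> ('k^'m^'m) set \<Rightarrow> ('k^'m^'m \<Rightarrow> 'x \<Rightarrow> 'x) \<Rightarrow>
   (('k^'m^'m \<Rightarrow> 'k) \<times> nat) set" where
  "weight_index sc T \<rho> = (SIGMA \<eta>:characters T. {..<dual_weight_mult sc T \<rho> \<eta>})"

definition quasi_symmetric ::
  "('k::field \<Rightarrow> 'x::ab_group_add \<Rightarrow> 'x) \<Rightarrow> ('k^'m^'m) set \<Rightarrow> ('k^'m^'m \<Rightarrow> 'x \<Rightarrow> 'x) \<Rightarrow>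
   'v::euclidean_space set \<Rightarrow> (('k^'m^'m \<Rightarrow> 'k) \<Rightarrow> 'v) \<Rightarrow> bool" where
  "quasi_symmetric sc T \<rho> V \<iota> \<longleftrightarrow>
     (\<forall>L \<subseteq> V. subspace L \<and> dim L = 1 \<longrightarrow>
        (\<Sum>i \<in> {i \<in> weight_index sc T \<rho>. \<iota> (fst i) \<in> L}. \<iota> (fst i)) = 0)"

definition Sigma_bar ::
  "('k::field \<Rightarrow> 'x::ab_group_add \<Rightarrow> 'x) \<Rightarrow> ('k^'m^'m) set \<Rightarrow> ('k^'m^'m \<Rightarrow> 'x \<Rightarrow> 'x) \<Rightarrow>
   (('k^'m^'m \<Rightarrow> 'k) \<Rightarrow> 'v::euclidean_space) \<Rightarrow> 'v set" where
  "Sigma_bar sc T \<rho> \<iota> =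
     {\<Sum>i \<in> weight_index sc T \<rho>. a i *\<^sub>R \<iota> (fst i) | a.
        \<forall>i \<in> weight_index sc T \<rho>. a i \<in> {-1..0}}"

definition facet_arrangement :: "'v::euclidean_space set \<Rightarrow> 'v set set" where
  "facet_arrangement P = {H. subspace H \<and> (\<exists>F. F facet_of P \<and> affine_parallel (affine hull F) H)}"

section \<open>GIT chambers\<close>

text \<open>
  The limit of \<open>\<gamma>(s) \<cdot> x\<close> as \<open>s\<close> tends to 0 exists if the orbit map extends from the multiplicative
  group to the affine line.
\<close>

definition limit_exists ::
  "('k::field \<Rightarrow> 'x::ab_group_add \<Rightarrow> 'x) \<Rightarrow> ('k^'m^'m \<Rightarrow> 'x \<Rightarrow> 'x) \<Rightarrow> ('k \<Rightarrow> 'k^'m^'m) \<Rightarrow> 'x \<Rightarrow> bool" where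
  "limit_exists sc \<rho> \<gamma> x \<longleftrightarrow>
     (\<forall>\<phi>. functional sc \<phi> \<longrightarrow> (\<exists>p. \<forall>s. s \<noteq> 0 \<longrightarrow> \<phi> (\<rho> (\<gamma> s) x) = poly p s))"

definition semistable ::
  "('k::field \<Rightarrow> 'x::ab_group_add \<Rightarrow> 'x) \<Rightarrow> ('k^'m^'m) set \<Rightarrow> ('k^'m^'m \<Rightarrow> 'x \<Rightarrow> 'x) \<Rightarrow>
   (('k^'m^'m \<Rightarrow> 'k) \<Rightarrow> 'v::euclidean_space) \<Rightarrow> 'v \<Rightarrow> 'x set" where
  "semistable sc T \<rho> \<iota> l =
     {x. \<forall>\<gamma> \<in> cocharacters T. limit_exists sc \<rho> \<gamma> x \<longrightarrow> real_pairing T \<iota> \<gamma> l \<le> 0}"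

definition git_chambers ::
  "('k::field \<Rightarrow> 'x::ab_group_add \<Rightarrow> 'x) \<Rightarrow> ('k^'m^'m) set \<Rightarrow> ('k^'m^'m \<Rightarrow> 'x \<Rightarrow> 'x) \<Rightarrow>
   'v::euclidean_space set \<Rightarrow> (('k^'m^'m \<Rightarrow> 'k) \<Rightarrow> 'v) \<Rightarrow> 'v set set" where
  "git_chambers sc T \<rho> V \<iota> =
     components {l \<in> V. \<forall>x \<in> semistable sc T \<rho> \<iota> l. finite (stabilizer T \<rho> x)}"

end

theory Submission
  imports Defs
begin

text \<open>
  Both sides turn out to be the components of one and the same set, because the locus of real
  characters without strictly semistable points is the complement of the arrangement.

  \<^item> Stability is read off from the weights.  Write a point \<open>x\<close> as a sum of weight vectors and let
  \<open>supp x\<close> be the set of weights of the dual representation that do not vanish at \<open>x\<close>; every set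
  of weights is the support of some point (\<open>exists_supp_eq\<close>).  A one-parameter subgroup has a limit
  at \<open>x\<close> iff it pairs nonpositively with \<open>supp x\<close> (\<open>limit_exists_iff\<close>).  By Farkas' lemma over the
  integers, \<open>x\<close> is semistable for \<open>l\<close> iff \<open>l\<close> lies in the convex cone of \<open>supp x\<close>
  (\<open>semistable_iff\<close>).  The stabilizer of \<open>x\<close> is the common kernel of the characters in \<open>supp x\<close>, and
  hence finite iff \<open>supp x\<close> spans \<open>V\<close>.  So \<open>l\<close> lies in the stable locus iff no set of weights that
  fails to span \<open>V\<close> has \<open>l\<close> in its cone (\<open>stable_locus\<close>).

  \<^item> The facets of the zonotope of the weights are parallel to the hyperplanes of \<open>V\<close> that are spanned
  by the weights they contain (\<open>facet_arrangement_zonotope\<close>): the points of the zonotope where a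
  linear functional is maximal form a translate of the zonotope of the weights on which the
  functional vanishes.

  \<^item> Quasi-symmetry makes the negative of a weight a sum of other weights on the same line.  So the
  weights in a linear subspace have a linear subspace as their cone, namely their span
  (\<open>balanced_cone_eq_span\<close>).  A point of a hyperplane of the arrangement is therefore in the cone of
  the weights in this hyperplane, which do not span \<open>V\<close>.  Conversely a set of weights that does not
  span \<open>V\<close> is contained in a hyperplane of the arrangement, and so is its cone
  (\<open>stable_locus_eq_arrangement_complement\<close>).

  The translation between points of the torus and lattices rests on the linear independence of
  characters: a regular function on a power of the multiplicative group has a unique expansion into
  Laurent monomials, and a nowhere vanishing multiplicative one is a single monomial.  Uniqueness
  also yields the weight decomposition, by taking the coefficients of the orbit maps.  Real solutions of linear conditions
  are replaced by integral ones with Dirichlet's simultaneous approximation: an integer that differs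
  from 0 by less than 1 is 0, so a sufficiently good approximation of a multiple of the real solution
  satisfies the conditions with integral coefficients exactly.
\<close>

section \<open>Facets of zonotopes\<close>

definition zonotope :: "'i set \<Rightarrow> ('i \<Rightarrow> 'v::real_vector) \<Rightarrow> 'v set" where
  "zonotope I b = {\<Sum>i\<in>I. a i *\<^sub>R b i | a. \<forall>i\<in>I. a i \<in> {-1..0}}"

lemma zonotopeI: "(\<And>i. i \<in> I \<Longrightarrow> -1 \<le> a i \<and> a i \<le> 0) \<Longrightarrow> (\<Sum>i\<in>I. a i *\<^sub>R b i) \<in> zonotope I b"
  unfolding zonotope_def by fastforce

text \<open>
  A zonotope is a Minkowski sum of segments, hence the convex hull of the finitely many sums of their
  end points.
\<close>

lemma polytope_zonotope:
  fixes b :: "'i \<Rightarrow> 'v::euclidean_space"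
  assumes "finite I"
  shows "polytope (zonotope I b)"
proof -
  have "zonotope I b = (\<Sum>i\<in>I. closed_segment (- b i) 0)"
  proof -
    have seg: "x \<in> closed_segment (- b i) 0 \<longleftrightarrow> (\<exists>a. a \<in> {-1..0} \<and> x = a *\<^sub>R b i)" for x i
    proof
      assume "x \<in> closed_segment (- b i) 0"
      then obtain u where "0 \<le> u" "u \<le> 1" "x = (1 - u) *\<^sub>R (- b i)"
        by (auto simp: in_segment)
      then show "\<exists>a. a \<in> {-1..0} \<and> x = a *\<^sub>R b i"
        by (intro exI[of _ "u - 1"]) (auto simp: algebra_simps)
    next
      assume "\<exists>a. a \<in> {-1..0} \<and> x = a *\<^sub>R b i"
      then obtain a where "a \<in> {-1..0}" "x = a *\<^sub>R b i" by blast
      then show "x \<in> closed_segment (- b i) 0"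
        by (auto simp: in_segment intro!: exI[of _ "a + 1"])
    qed
    show ?thesis
      unfolding set_sum_alt[OF assms] zonotope_def
    proof (intro set_eqI iffI; clarify)
      fix s assume "\<forall>i\<in>I. s i \<in> closed_segment (- b i) 0"
      then obtain a where "\<forall>i\<in>I. a i \<in> {-1..0} \<and> s i = a i *\<^sub>R b i"
        unfolding seg by metis
      then show "\<exists>a. sum s I = (\<Sum>i\<in>I. a i *\<^sub>R b i) \<and> (\<forall>i\<in>I. a i \<in> {-1..0})"
        by (intro exI[of _ a]) auto
    next
      fix a :: "'i \<Rightarrow> real" assume "\<forall>i\<in>I. a i \<in> {-1..0}"
      then show "\<exists>s. (\<Sum>i\<in>I. a i *\<^sub>R b i) = sum s I \<and> (\<forall>i\<in>I. s i \<in> closed_segment (- b i) 0)"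
        unfolding seg by (intro exI[of _ "\<lambda>i. a i *\<^sub>R b i"]) auto
    qed
  qed
  also have "\<dots> = convex hull (\<Sum>i\<in>I. {- b i, 0})"
    by (simp add: convex_hull_set_sum segment_convex_hull)
  finally show ?thesis
    by (simp add: polytope_convex_hull finite_set_sum)
qed

lemma zero_in_zonotope: "0 \<in> zonotope I b"
  using zonotopeI[of I "\<lambda>_. 0" b] by simp

lemma span_zonotope:
  assumes "finite I"
  shows "span (zonotope I b) = span (b ` I)"
proof (rule antisym; rule span_minimal)
  show "zonotope I b \<subseteq> span (b ` I)"
    unfolding zonotope_def by (safe, intro span_sum span_scale, simp add: span_base)
  show "b ` I \<subseteq> span (zonotope I b)"
  proof clarify
    fix i assume i: "i \<in> I"
    have "(\<Sum>j\<in>I. (if j = i then -1 else 0) *\<^sub>R b j) = - b i"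
      using i assms by (simp add: if_distrib[where f = "\<lambda>x. x *\<^sub>R _"] sum.delta cong: if_cong)
    then have "- b i \<in> zonotope I b"
      using zonotopeI[of I "\<lambda>j. if j = i then -1 else 0" b] by simp
    then show "b i \<in> span (zonotope I b)"
      using span_base span_neg by fastforce
  qed
qed simp_all

lemma aff_dim_zonotope:
  fixes b :: "'i \<Rightarrow> 'v::euclidean_space"
  assumes "finite I"
  shows "aff_dim (zonotope I b) = int (dim (b ` I))"
  by (metis aff_dim_zero assms dim_span hull_inc span_zonotope zero_in_zonotope)

text \<open>
  A linear functional is maximized summand by summand.  The coefficient of a vector on which it is
  negative or positive is forced to be \<open>-1\<close> or \<open>0\<close>, and the coefficient of a vector on which it
  vanishes remains free.
\<close>

lemma zonotope_face:
  fixes b :: "'i \<Rightarrow> 'v::euclidean_space" and u :: 'v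
  assumes "finite I"
  defines "c \<equiv> \<Sum>i\<in>I. max 0 (- (u \<bullet> b i))"
    and "z0 \<equiv> \<Sum>i\<in>{i\<in>I. u \<bullet> b i < 0}. - b i"
  shows zonotope_supporting: "z \<in> zonotope I b \<Longrightarrow> u \<bullet> z \<le> c"
    and zonotope_Int_supporting:
      "zonotope I b \<inter> {z. u \<bullet> z = c} = (+) z0 ` zonotope {i\<in>I. u \<bullet> b i = 0} b"
proof -
  have le: "x * (u \<bullet> b i) \<le> max 0 (- (u \<bullet> b i))" if "-1 \<le> x" "x \<le> 0" for x i
  proof (cases "u \<bullet> b i \<ge> 0")
    case True then show ?thesis using that by (simp add: max_def mult_nonpos_nonneg)
  next
    case False
    then have "(x + 1) * (u \<bullet> b i) \<le> 0" using that by (simp add: mult_nonneg_nonpos)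
    then show ?thesis using False by (simp add: algebra_simps)
  qed
  have inn: "u \<bullet> (\<Sum>i\<in>I. a i *\<^sub>R b i) = (\<Sum>i\<in>I. a i * (u \<bullet> b i))" for a
    by (simp add: inner_sum_right)
  show "u \<bullet> z \<le> c" if "z \<in> zonotope I b" for z
    using that unfolding zonotope_def c_def by (auto simp: inn intro!: sum_mono le)
  let ?J = "{i\<in>I. u \<bullet> b i = 0}"
  let ?N = "{i\<in>I. u \<bullet> b i < 0}"
  have split: "(\<Sum>i\<in>I. a i *\<^sub>R b i) = z0 + (\<Sum>i\<in>?J. a i *\<^sub>R b i)"
    if "\<And>i. i \<in> I \<Longrightarrow> u \<bullet> b i < 0 \<Longrightarrow> a i = -1" "\<And>i. i \<in> I \<Longrightarrow> u \<bullet> b i > 0 \<Longrightarrow> a i = 0" for a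
  proof -
    have "(\<Sum>i\<in>I. a i *\<^sub>R b i) = (\<Sum>i\<in>?N \<union> ?J. a i *\<^sub>R b i)"
      using assms(1) that by (intro sum.mono_neutral_right) force+
    also have "\<dots> = (\<Sum>i\<in>?N. a i *\<^sub>R b i) + (\<Sum>i\<in>?J. a i *\<^sub>R b i)"
      using assms(1) by (intro sum.union_disjoint) auto
    also have "(\<Sum>i\<in>?N. a i *\<^sub>R b i) = z0"
      unfolding z0_def using that by (intro sum.cong) auto
    finally show ?thesis .
  qed
  show "zonotope I b \<inter> {z. u \<bullet> z = c} = (+) z0 ` zonotope ?J b"
  proof (intro set_eqI iffI)
    fix z assume "z \<in> zonotope I b \<inter> {z. u \<bullet> z = c}"
    then obtain a where a: "\<forall>i\<in>I. a i \<in> {-1..0}" and z: "z = (\<Sum>i\<in>I. a i *\<^sub>R b i)" and "u \<bullet> z = c"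
      unfolding zonotope_def by auto
    then have eq: "(\<Sum>i\<in>I. max 0 (- (u \<bullet> b i)) - a i * (u \<bullet> b i)) = 0"
      by (simp add: inn c_def sum_subtractf)
    have "\<forall>i\<in>I. max 0 (- (u \<bullet> b i)) - a i * (u \<bullet> b i) = 0"
      using sum_nonneg_eq_0_iff[THEN iffD1, OF assms(1) _ eq] le a by fastforce
    then have "a i = -1" if "i \<in> I" "u \<bullet> b i < 0" for i
    proof -
      have "max 0 (- (u \<bullet> b i)) = - (u \<bullet> b i)" using that(2) by simp
      then have "- (u \<bullet> b i) - a i * (u \<bullet> b i) = 0"
        using \<open>\<forall>i\<in>I. max 0 (- (u \<bullet> b i)) - a i * (u \<bullet> b i) = 0\<close> that(1) by metis
      then have "(a i + 1) * (u \<bullet> b i) = 0" by (simp only: distrib_right mult_1)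
      then show ?thesis using that(2) by (simp only: mult_eq_0_iff) linarith
    qed
    moreover have "a i = 0" if "i \<in> I" "u \<bullet> b i > 0" for i
      using that \<open>\<forall>i\<in>I. max 0 (- (u \<bullet> b i)) - a i * (u \<bullet> b i) = 0\<close> by (force simp: max_def)
    ultimately have "z = z0 + (\<Sum>i\<in>?J. a i *\<^sub>R b i)"
      using split z by blast
    then show "z \<in> (+) z0 ` zonotope ?J b"
      using a by (auto intro!: zonotopeI)
  next
    fix z assume "z \<in> (+) z0 ` zonotope ?J b"
    then obtain a where a: "\<forall>i\<in>?J. a i \<in> {-1..0}" and z: "z = z0 + (\<Sum>i\<in>?J. a i *\<^sub>R b i)"
      unfolding zonotope_def by auto
    define a' where "a' i = (if u \<bullet> b i < 0 then -1 else if u \<bullet> b i = 0 then a i else 0)" for i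
    have z': "z = (\<Sum>i\<in>I. a' i *\<^sub>R b i)"
      by (subst split) (auto simp: a'_def z intro!: sum.cong)
    have "z \<in> zonotope I b"
      unfolding z' using a by (intro zonotopeI) (auto simp: a'_def)
    moreover have "u \<bullet> z = c"
      unfolding z' inn c_def by (intro sum.cong) (auto simp: a'_def max_def)
    ultimately show "z \<in> zonotope I b \<inter> {z. u \<bullet> z = c}" by simp
  qed
qed

text \<open>
  The zonotope contains the origin, so its affine hull is the span of its vectors.
\<close>

lemma affine_parallel_zonotope_translate:
  fixes b :: "'i \<Rightarrow> 'v::euclidean_space"
  assumes "finite J" "subspace H"
  shows "affine_parallel (affine hull ((+) z ` zonotope J b)) H \<longleftrightarrow> H = span (b ` J)"
proof -
  have "affine hull ((+) z ` zonotope J b) = (+) z ` span (b ` J)"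
    by (metis affine_hull_span_0 affine_hull_translation assms(1) hull_inc span_zonotope zero_in_zonotope)
  moreover have par: "affine_parallel ((+) z ` span (b ` J)) (span (b ` J))"
    using affine_parallel_commute affine_parallel_def by blast
  ultimately show ?thesis
    by (metis affine_parallel_assoc affine_parallel_commute assms(2) parallel_subspace subspace_span)
qed

text \<open>
  The direction of a face is the span of the vectors orthogonal to a supporting functional, and the face
  is a facet if this span is a hyperplane.  Conversely, a hyperplane spanned by some of the vectors is
  the kernel of a functional, whose maximum on the zonotope is taken on a facet parallel to it.
\<close>

lemma facet_arrangement_zonotope:
  fixes b :: "'i \<Rightarrow> 'v::euclidean_space"
  assumes fin: "finite I"
  shows "facet_arrangement (zonotope I b) =
    {H. subspace H \<and> H \<subseteq> span (b ` I) \<and> Suc (dim H) = dim (b ` I) \<and> span (b ` I \<inter> H) = H}"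
    (is "_ = ?R")
proof (intro set_eqI iffI)
  let ?Z = "zonotope I b"
  fix H assume "H \<in> facet_arrangement ?Z"
  then obtain F where H: "subspace H" and F: "F facet_of ?Z" and par: "affine_parallel (affine hull F) H"
    unfolding facet_arrangement_def by blast
  obtain u c where u: "?Z \<subseteq> {x. u \<bullet> x \<le> c}" "F = ?Z \<inter> {x. u \<bullet> x = c}"
    using facet_of_polyhedron[OF polytope_imp_polyhedron[OF polytope_zonotope[OF fin]] F] by metis
  define c' where "c' = (\<Sum>i\<in>I. max 0 (- (u \<bullet> b i)))"
  let ?J = "{i\<in>I. u \<bullet> b i = 0}"
  define z0 where "z0 = (\<Sum>i\<in>{i\<in>I. u \<bullet> b i < 0}. - b i)"
  have face: "?Z \<inter> {z. u \<bullet> z = c'} = (+) z0 ` zonotope ?J b"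
    unfolding c'_def z0_def by (rule zonotope_Int_supporting[OF fin])
  \<comment> \<open>the given supporting hyperplane touches the zonotope, so its level is the maximum\<close>
  have "c = c'"
  proof (rule antisym)
    obtain z where "z \<in> F" using F by (auto simp: facet_of_def)
    then show "c \<le> c'"
      using zonotope_supporting[OF fin, of z b u] u unfolding c'_def by auto
    have "z0 + 0 \<in> ?Z \<inter> {z. u \<bullet> z = c'}"
      unfolding face by (intro imageI zero_in_zonotope)
    then show "c' \<le> c" using u(1) by auto
  qed
  then have F': "F = (+) z0 ` zonotope ?J b" using u(2) face by simp
  have finJ: "finite ?J" using fin by simp
  have HJ: "H = span (b ` ?J)"
    using par affine_parallel_zonotope_translate[OF finJ H] unfolding F' by blast
  have "aff_dim F = int (dim (b ` ?J))"
    unfolding F' by (simp add: aff_dim_translation_eq aff_dim_zonotope finJ)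
  moreover have "aff_dim F = aff_dim ?Z - 1" using F by (simp add: facet_of_def)
  ultimately have "Suc (dim H) = dim (b ` I)"
    using aff_dim_zonotope[OF fin, of b] HJ by simp
  moreover have "H \<subseteq> span (b ` I)" unfolding HJ by (intro span_mono) auto
  moreover have "span (b ` I \<inter> H) = H"
  proof (rule antisym)
    show "span (b ` I \<inter> H) \<subseteq> H" using H by (simp add: span_minimal)
    have "b ` ?J \<subseteq> H" unfolding HJ by (rule span_superset)
    then show "H \<subseteq> span (b ` I \<inter> H)"
      using span_mono[of "b ` ?J" "b ` I \<inter> H"] HJ by blast
  qed
  ultimately show "H \<in> ?R" using H by simp
next
  let ?Z = "zonotope I b"
  fix H assume "H \<in> ?R"
  then have H: "subspace H" "H \<subseteq> span (b ` I)" "Suc (dim H) = dim (b ` I)" "span (b ` I \<inter> H) = H"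
    by auto
  have "span H \<subset> span (b ` I)"
    using H by (metis dim_span n_not_Suc_n psubsetI span_eq_iff)
  then obtain u where u: "u \<noteq> 0" "u \<in> span (b ` I)" "\<And>y. y \<in> span H \<Longrightarrow> orthogonal u y"
    using orthogonal_to_subspace_exists_gen by blast
  have HH: "span H = H" using H(1) by (simp add: span_eq_iff)
  have sub: "H \<subseteq> {x \<in> span (b ` I). u \<bullet> x = 0}"
    using u(3) H(2) unfolding orthogonal_def HH by auto
  have ss: "subspace {x \<in> span (b ` I). u \<bullet> x = 0}"
    by (auto simp: subspace_def inner_add_right span_add span_scale span_zero)
  have "{x \<in> span (b ` I). u \<bullet> x = 0} \<subset> span (b ` I)"
  proof
    have "u \<notin> {x \<in> span (b ` I). u \<bullet> x = 0}" using u(1) by simp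
    then show "{x \<in> span (b ` I). u \<bullet> x = 0} \<noteq> span (b ` I)" using u(2) by blast
  qed blast
  then have "dim {x \<in> span (b ` I). u \<bullet> x = 0} < dim (b ` I)"
    using dim_psubset[of "{x \<in> span (b ` I). u \<bullet> x = 0}" "span (b ` I)"]
    by (simp only: span_eq_iff[THEN iffD2, OF ss] span_span dim_span)
  then have Heq: "H = {x \<in> span (b ` I). u \<bullet> x = 0}"
    using subspace_dim_equal[OF H(1) ss sub] H(3) by simp
  let ?J = "{i\<in>I. u \<bullet> b i = 0}"
  have bJ: "b ` I \<inter> H = b ` ?J"
    unfolding Heq by (auto intro: span_base)
  define c where "c = (\<Sum>i\<in>I. max 0 (- (u \<bullet> b i)))"
  define z0 where "z0 = (\<Sum>i\<in>{i\<in>I. u \<bullet> b i < 0}. - b i)"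
  have face: "?Z \<inter> {z. u \<bullet> z = c} = (+) z0 ` zonotope ?J b" (is "?F = _")
    unfolding c_def z0_def by (rule zonotope_Int_supporting[OF fin])
  have finJ: "finite ?J" using fin by simp
  have "?F face_of ?Z"
    using zonotope_supporting[OF fin, of _ b u] polytope_imp_convex[OF polytope_zonotope[OF fin]]
    unfolding c_def by (intro face_of_Int_supporting_hyperplane_le) auto
  moreover have "?F \<noteq> {}"
    unfolding face using zero_in_zonotope[of ?J b] by blast
  moreover have "aff_dim ?F = aff_dim ?Z - 1"
  proof -
    have "aff_dim ?F = int (dim (b ` ?J))"
      unfolding face by (simp add: aff_dim_translation_eq aff_dim_zonotope finJ)
    also have "dim (b ` ?J) = dim H" using H(4) bJ by (metis dim_span)
    finally show ?thesis using H(3) aff_dim_zonotope[OF fin, of b] by simp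
  qed
  ultimately have "?F facet_of ?Z" by (simp add: facet_of_def)
  moreover have "affine_parallel (affine hull ?F) H"
    unfolding face affine_parallel_zonotope_translate[OF finJ H(1)] using H(4) bJ by simp
  ultimately show "H \<in> facet_arrangement ?Z"
    unfolding facet_arrangement_def using H(1) by blast
qed

section \<open>Cones over balanced configurations\<close>

lemma convex_cone_hull_subset_span: "convex_cone hull S \<subseteq> span S"
  by (rule hull_minimal)
     (auto simp: span_superset convex_cone_iff span_zero span_add span_scale)

text \<open>
  A convex cone that is closed under negation is a linear subspace.
\<close>

lemma convex_cone_hull_eq_span:
  fixes S :: "'v::real_vector set"
  assumes "\<And>x. x \<in> S \<Longrightarrow> - x \<in> convex_cone hull S"
  shows "convex_cone hull S = span S"
proof (rule antisym[OF convex_cone_hull_subset_span])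
  let ?K = "convex_cone hull S"
  have "uminus ` ?K = convex_cone hull (uminus ` S)"
    by (simp add: convex_cone_hull_linear_image linear_uminus)
  also have "\<dots> \<subseteq> ?K"
    using assms by (intro hull_minimal convex_cone_convex_cone_hull) auto
  finally have neg: "- x \<in> ?K" if "x \<in> ?K" for x using that by blast
  have "subspace ?K"
    unfolding subspace_def
  proof (intro conjI ballI allI)
    fix c :: real and x assume x: "x \<in> ?K"
    show "c *\<^sub>R x \<in> ?K"
    proof (cases "c \<ge> 0")
      case False
      then have "(- c) *\<^sub>R (- x) \<in> ?K" using neg[OF x] by (intro convex_cone_hull_mul) auto
      then show ?thesis by simp
    qed (simp add: x convex_cone_hull_mul)
  qed (auto simp: convex_cone_hull_contains_0 convex_cone_hull_add)
  then show "span S \<subseteq> ?K" by (intro span_minimal hull_subset)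
qed

lemma sum_in_convex_cone_hull:
  "(\<And>i. i \<in> A \<Longrightarrow> f i \<in> convex_cone hull S) \<Longrightarrow> sum f A \<in> convex_cone hull S"
  by (induction A rule: infinite_finite_induct)
     (auto simp: convex_cone_hull_contains_0 convex_cone_hull_add)

text \<open>
  The members of the configuration on the line through a nonzero vector \<open>b i\<close> add up to zero, so that
  \<open>- b i\<close> is the sum of the other members on this line.
\<close>

lemma balanced_cone_eq_span:
  fixes b :: "'i \<Rightarrow> 'v::euclidean_space"
  assumes fin: "finite I"
    and bal: "\<And>L. subspace L \<Longrightarrow> L \<subseteq> span (b ` I) \<Longrightarrow> dim L = 1 \<Longrightarrow> (\<Sum>i\<in>{i\<in>I. b i \<in> L}. b i) = 0"
    and H: "subspace H"
  shows "convex_cone hull (b ` I \<inter> H) = span (b ` I \<inter> H)"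
proof (rule convex_cone_hull_eq_span)
  let ?K = "convex_cone hull (b ` I \<inter> H)"
  fix x assume "x \<in> b ` I \<inter> H"
  then obtain i where i: "i \<in> I" "x = b i" "b i \<in> H" by auto
  show "- x \<in> ?K"
  proof (cases "x = 0")
    case True then show ?thesis by (simp add: convex_cone_hull_contains_0)
  next
    case False
    let ?L = "span {x}" and ?A = "{j\<in>I. b j \<in> span {x}}"
    have "?L \<subseteq> span (b ` I)" using i by (intro span_mono) auto
    moreover have "dim ?L = 1" using False by simp
    ultimately have "(\<Sum>j\<in>?A. b j) = 0" by (intro bal) auto
    moreover have "(\<Sum>j\<in>?A. b j) = b i + (\<Sum>j\<in>?A - {i}. b j)"
      using i fin by (intro sum.remove) (auto simp: span_base)
    ultimately have "- x = (\<Sum>j\<in>?A - {i}. b j)" using i by (simp add: eq_neg_iff_add_eq_0 minus_equation_iff[of x] add.commute minus_unique)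
    moreover have "?L \<subseteq> H" using i H by (intro span_minimal) auto
    then have "(\<Sum>j\<in>?A - {i}. b j) \<in> ?K"
      by (intro sum_in_convex_cone_hull hull_inc) auto
    ultimately show ?thesis by simp
  qed
qed

text \<open>
  Choose \<open>S'\<close> maximal among the subsets of \<open>W\<close> that contain \<open>S\<close> and have a smaller span than \<open>W\<close>.
  Adding any vector of \<open>W\<close> outside \<open>span S'\<close> then gives all of \<open>span W\<close>, so that only one dimension
  is missing.
\<close>

lemma extend_to_hyperplane:
  fixes S W :: "'v::euclidean_space set"
  assumes "finite W" "S \<subseteq> W" "span S \<noteq> span W"
  obtains S' where "S \<subseteq> S'" "S' \<subseteq> W" "Suc (dim S') = dim W"
proof -
  let ?P = "{S'. S \<subseteq> S' \<and> S' \<subseteq> W \<and> span S' \<noteq> span W}"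
  have "finite ?P" using assms(1) by (intro finite_subset[of ?P "Pow W"]) auto
  moreover have "S \<in> ?P" using assms by auto
  ultimately obtain S' where S': "S' \<in> ?P" "\<And>A. A \<in> ?P \<Longrightarrow> S' \<subseteq> A \<Longrightarrow> A = S'"
    using finite_has_maximal[of ?P] by (metis (no_types, lifting) empty_iff)
  obtain w where w: "w \<in> W" "w \<notin> span S'"
  proof -
    have "\<not> W \<subseteq> span S'"
      using S'(1) span_minimal[of W "span S'"] span_mono[of S' W] by auto
    then show ?thesis using that by blast
  qed
  have "insert w S' \<noteq> S'" using w(2) span_base[of w S'] by auto
  then have "span (insert w S') = span W" using S' w by blast
  then have "dim W = dim (insert w S')" by (metis dim_span)
  then have "Suc (dim S') = dim W" using w by (simp add: dim_insert)
  then show ?thesis using that S'(1) by blast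
qed

text \<open>
  A vector \<open>l\<close> on a hyperplane of the arrangement lies in the span of the configuration vectors on this
  hyperplane, which by balancedness is also their cone.  In the other direction, a set of vectors that
  does not span, but whose cone contains \<open>l\<close>, extends to a set spanning a hyperplane of the arrangement.
\<close>

theorem stable_locus_eq_arrangement_complement:
  fixes b :: "'i \<Rightarrow> 'v::euclidean_space"
  assumes fin: "finite I"
    and bal: "\<And>L. subspace L \<Longrightarrow> L \<subseteq> span (b ` I) \<Longrightarrow> dim L = 1 \<Longrightarrow> (\<Sum>i\<in>{i\<in>I. b i \<in> L}. b i) = 0"
  shows "{l \<in> span (b ` I). \<forall>S\<subseteq>b ` I. l \<in> convex_cone hull S \<longrightarrow> span S = span (b ` I)} =
    span (b ` I) - \<Union> (facet_arrangement (zonotope I b))"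
    (is "?C = ?D")
proof (intro set_eqI iffI)
  fix l assume l: "l \<in> ?C"
  have False if "H \<in> facet_arrangement (zonotope I b)" "l \<in> H" for H
  proof -
    have H: "subspace H" "Suc (dim H) = dim (b ` I)" "span (b ` I \<inter> H) = H"
      using that(1) unfolding facet_arrangement_zonotope[OF fin] by auto
    have "l \<in> convex_cone hull (b ` I \<inter> H)"
      using balanced_cone_eq_span[OF fin bal H(1)] H(3) that(2) by simp
    then have "H = span (b ` I)" using l H(3) by auto
    then show False using H(2) by simp
  qed
  then show "l \<in> ?D" using l by blast
next
  fix l assume l: "l \<in> ?D"
  have "span S = span (b ` I)" if S: "S \<subseteq> b ` I" "l \<in> convex_cone hull S" for S
  proof (rule ccontr)
    assume "span S \<noteq> span (b ` I)"
    then obtain S' where S': "S \<subseteq> S'" "S' \<subseteq> b ` I" "Suc (dim S') = dim (b ` I)"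
      using extend_to_hyperplane[of "b ` I" S] fin S by blast
    let ?H = "span S'"
    have "?H \<subseteq> span (b ` I)" using S'(2) by (rule span_mono)
    moreover have "span (b ` I \<inter> ?H) = ?H"
      using S'(2) span_mono[of S' "b ` I \<inter> ?H"] span_superset[of S']
      by (intro antisym span_minimal) auto
    ultimately have "?H \<in> facet_arrangement (zonotope I b)"
      unfolding facet_arrangement_zonotope[OF fin] using S'(3) by simp
    moreover have "l \<in> ?H"
      using S(2) convex_cone_hull_subset_span[of S] span_mono[OF S'(1)] by blast
    ultimately show False using l by blast
  qed
  then show "l \<in> ?C" using l by blast
qed

section \<open>Rounding real solutions to integral ones\<close>

lemma simultaneous_approximation:
  fixes c :: "'j \<Rightarrow> real"
  assumes "finite J" "\<epsilon> > 0"
  obtains N :: int and p :: "'j \<Rightarrow> int"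
  where "N > 0" "\<And>j. j \<in> J \<Longrightarrow> \<bar>of_int N * c j - of_int (p j)\<bar> < \<epsilon>"
proof -
  obtain M :: nat where M: "M > 0" "1 / real M < \<epsilon>"
    using assms(2) by (metis nat_approx_posE zero_less_Suc)
  obtain f where f: "bij_betw f {..<card J} J"
    using assms(1) by (metis ex_bij_betw_nat_finite atLeast0LessThan)
  obtain q p where q: "0 < q" "\<And>i. i < card J \<Longrightarrow> \<bar>of_int q * c (f i) - of_int (p i)\<bar> < 1 / M"
    using Dirichlet_approx_simult[OF M(1), of "card J" "c \<circ> f"] by (metis comp_apply)
  show ?thesis
  proof (rule that[of q "\<lambda>j. p (inv_into {..<card J} f j)"])
    fix j assume j: "j \<in> J"
    let ?i = "inv_into {..<card J} f j"
    have "f ?i = j" "?i < card J"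
      using f j by (auto simp: bij_betw_def f_inv_into_f inv_into_into lessThan_iff[symmetric] simp del: lessThan_iff)
    then show "\<bar>of_int q * c j - of_int (p ?i)\<bar> < \<epsilon>"
      using q(2)[of ?i] M(2) by simp
  qed (use q in simp)
qed

text \<open>
  The integral linear form with coefficients \<open>p\<close> approximates a multiple of the real linear form with
  coefficients \<open>c\<close>, uniformly on a finite set of vectors.
\<close>

lemma simultaneous_approximation_weighted:
  fixes c :: "'j \<Rightarrow> real" and W :: "('j \<Rightarrow> real) set"
  assumes "finite J" "finite W" "\<epsilon> > 0"
  obtains N :: int and p :: "'j \<Rightarrow> int"
  where "N > 0" "\<And>w. w \<in> W \<Longrightarrow> \<bar>of_int N * (\<Sum>j\<in>J. c j * w j) - (\<Sum>j\<in>J. of_int (p j) * w j)\<bar> < \<epsilon>"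
proof -
  define K where "K = 1 + (\<Sum>w\<in>W. \<Sum>j\<in>J. \<bar>w j\<bar>)"
  have K: "K > 0" "\<And>w. w \<in> W \<Longrightarrow> (\<Sum>j\<in>J. \<bar>w j\<bar>) < K"
  proof -
    show "K > 0" unfolding K_def by (simp add: sum_nonneg add_pos_nonneg)
    fix w assume "w \<in> W"
    then have "(\<Sum>j\<in>J. \<bar>w j\<bar>) \<le> (\<Sum>w\<in>W. \<Sum>j\<in>J. \<bar>w j\<bar>)"
      using assms(2) by (intro member_le_sum) (auto simp: sum_nonneg)
    then show "(\<Sum>j\<in>J. \<bar>w j\<bar>) < K" unfolding K_def by simp
  qed
  obtain N p where N: "N > 0" and p: "\<And>j. j \<in> J \<Longrightarrow> \<bar>of_int N * c j - of_int (p j)\<bar> < \<epsilon> / K"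
    using simultaneous_approximation[OF assms(1), of "\<epsilon> / K" c] assms(3) K(1) by auto
  show ?thesis
  proof (rule that[OF N, of p])
    fix w assume w: "w \<in> W"
    have "\<bar>of_int N * (\<Sum>j\<in>J. c j * w j) - (\<Sum>j\<in>J. of_int (p j) * w j)\<bar>
        = \<bar>\<Sum>j\<in>J. (of_int N * c j - of_int (p j)) * w j\<bar>"
      by (simp add: sum_distrib_left sum_subtractf left_diff_distrib mult.assoc)
    also have "\<dots> \<le> (\<Sum>j\<in>J. \<bar>(of_int N * c j - of_int (p j)) * w j\<bar>)"
      by (rule sum_abs)
    also have "\<dots> \<le> (\<Sum>j\<in>J. \<epsilon> / K * \<bar>w j\<bar>)"
      unfolding abs_mult using p by (intro sum_mono mult_right_mono) (auto intro: less_imp_le)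
    also have "\<dots> = \<epsilon> / K * (\<Sum>j\<in>J. \<bar>w j\<bar>)" by (simp add: sum_distrib_left)
    also have "\<dots> < \<epsilon> / K * K"
      using K w assms(3) by (intro mult_strict_left_mono) auto
    finally show "\<bar>of_int N * (\<Sum>j\<in>J. c j * w j) - (\<Sum>j\<in>J. of_int (p j) * w j)\<bar> < \<epsilon>"
      using K(1) by simp
  qed
qed

text \<open>
  The values of the integral form at the integral vectors in \<open>A\<close> are integers less than 1.  The value
  at \<open>z\<close> remains positive because the approximated multiple of the real form is at least as large there
  as the form itself.
\<close>

lemma integral_separation:
  fixes c z :: "nat \<Rightarrow> real" and A :: "(nat \<Rightarrow> int) set"
  assumes "finite J" "finite A"
    and neg: "\<And>m. m \<in> A \<Longrightarrow> (\<Sum>j\<in>J. c j * of_int (m j)) \<le> 0"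
    and pos: "(\<Sum>j\<in>J. c j * z j) > 0"
  obtains p :: "nat \<Rightarrow> int" where "\<And>m. m \<in> A \<Longrightarrow> (\<Sum>j\<in>J. p j * m j) \<le> 0"
    "(\<Sum>j\<in>J. of_int (p j) * z j) > 0"
proof -
  \<comment> \<open>an error below 1 settles the integral inequalities, one below the value at \<open>z\<close> its sign\<close>
  define \<epsilon> where "\<epsilon> = min 1 (\<Sum>j\<in>J. c j * z j)"
  let ?W = "insert z ((\<lambda>m j. of_int (m j)) ` A)"
  obtain N p where N: "N > 0" and
    p: "\<And>w. w \<in> ?W \<Longrightarrow> \<bar>of_int N * (\<Sum>j\<in>J. c j * w j) - (\<Sum>j\<in>J. of_int (p j) * w j)\<bar> < \<epsilon>"
    using simultaneous_approximation_weighted[of J ?W \<epsilon> c] assms by (auto simp: \<epsilon>_def)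
  show ?thesis
  proof (rule that)
    fix m assume m: "m \<in> A"
    have "\<bar>of_int N * (\<Sum>j\<in>J. c j * of_int (m j)) - (\<Sum>j\<in>J. of_int (p j) * of_int (m j))\<bar> < 1"
      using p[of "\<lambda>j. of_int (m j)"] m by (auto simp: \<epsilon>_def)
    moreover have "of_int N * (\<Sum>j\<in>J. c j * of_int (m j)) \<le> 0"
      using N neg[OF m] by (simp add: mult_nonneg_nonpos)
    ultimately have "(\<Sum>j\<in>J. real_of_int (p j) * of_int (m j)) < 1" by linarith
    then have "real_of_int (\<Sum>j\<in>J. p j * m j) < 1" by simp
    then show "(\<Sum>j\<in>J. p j * m j) \<le> 0" by linarith
  next
    have "\<bar>of_int N * (\<Sum>j\<in>J. c j * z j) - (\<Sum>j\<in>J. of_int (p j) * z j)\<bar> < (\<Sum>j\<in>J. c j * z j)"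
      using p[of z] by (auto simp: \<epsilon>_def)
    moreover have "1 * (\<Sum>j\<in>J. c j * z j) \<le> of_int N * (\<Sum>j\<in>J. c j * z j)"
      using N pos by (intro mult_right_mono) auto
    ultimately show "(\<Sum>j\<in>J. of_int (p j) * z j) > 0" by linarith
  qed
qed

text \<open>
  Including a coordinate vector among the approximated values ensures that the \<open>i\<close>-th coefficient does
  not become zero.
\<close>

lemma integral_orthogonal:
  fixes c :: "nat \<Rightarrow> real" and A :: "(nat \<Rightarrow> int) set"
  assumes "finite J" "finite A"
    and orth: "\<And>m. m \<in> A \<Longrightarrow> (\<Sum>j\<in>J. c j * of_int (m j)) = 0"
    and i: "i \<in> J" "c i \<noteq> 0"
  obtains p :: "nat \<Rightarrow> int" where "\<And>m. m \<in> A \<Longrightarrow> (\<Sum>j\<in>J. p j * m j) = 0" "p i \<noteq> 0"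
proof -
  define \<epsilon> where "\<epsilon> = min 1 \<bar>c i\<bar>"
  let ?e = "\<lambda>j. if j = i then 1 else 0 :: real"
  let ?W = "insert ?e ((\<lambda>m j. of_int (m j)) ` A)"
  obtain N p where N: "N > 0" and
    p: "\<And>w. w \<in> ?W \<Longrightarrow> \<bar>of_int N * (\<Sum>j\<in>J. c j * w j) - (\<Sum>j\<in>J. of_int (p j) * w j)\<bar> < \<epsilon>"
    using simultaneous_approximation_weighted[of J ?W \<epsilon> c] assms by (auto simp: \<epsilon>_def)
  show ?thesis
  proof (rule that)
    fix m assume m: "m \<in> A"
    have "\<bar>of_int N * (\<Sum>j\<in>J. c j * of_int (m j)) - (\<Sum>j\<in>J. of_int (p j) * of_int (m j))\<bar> < 1"
      using p[of "\<lambda>j. of_int (m j)"] m by (auto simp: \<epsilon>_def)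
    then have "\<bar>real_of_int (\<Sum>j\<in>J. p j * m j)\<bar> < 1" using orth[OF m] by simp
    then show "(\<Sum>j\<in>J. p j * m j) = 0" by linarith
  next
    have "\<bar>of_int N * c i - of_int (p i)\<bar> < \<bar>c i\<bar>"
      using p[of ?e] i(1) assms(1) by (simp add: \<epsilon>_def if_distrib sum.delta cong: if_cong)
    moreover have "1 * \<bar>c i\<bar> \<le> \<bar>of_int N * c i\<bar>"
      unfolding abs_mult using N by (intro mult_right_mono) auto
    ultimately show "p i \<noteq> 0" by auto
  qed
qed

text \<open>
  Rounding the coefficients of a suitable multiple of the combination changes every coordinate by less
  than 1.  As both sides are integral, it changes nothing.
\<close>

lemma integral_combination:
  fixes c :: "'j \<Rightarrow> real" and w :: "'j \<Rightarrow> nat \<Rightarrow> int" and z :: "nat \<Rightarrow> int"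
  assumes "finite J" "finite R"
    and comb: "\<And>i. i \<in> R \<Longrightarrow> of_int (z i) = (\<Sum>j\<in>J. c j * of_int (w j i))"
  obtains N :: int and p :: "'j \<Rightarrow> int"
  where "N > 0" "\<And>i. i \<in> R \<Longrightarrow> N * z i = (\<Sum>j\<in>J. p j * w j i)"
proof -
  let ?W = "(\<lambda>i j. real_of_int (w j i)) ` R"
  obtain N p where N: "N > 0" and
    p: "\<And>v. v \<in> ?W \<Longrightarrow> \<bar>of_int N * (\<Sum>j\<in>J. c j * v j) - (\<Sum>j\<in>J. of_int (p j) * v j)\<bar> < 1"
    using simultaneous_approximation_weighted[of J ?W 1 c] assms(1,2) by auto
  show ?thesis
  proof (rule that[OF N, of p])
    fix i assume i: "i \<in> R"
    have "\<bar>real_of_int (N * z i - (\<Sum>j\<in>J. p j * w j i))\<bar> < 1"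
      using p[of "\<lambda>j. real_of_int (w j i)"] i by (simp add: comb[OF i])
    then show "N * z i = (\<Sum>j\<in>J. p j * w j i)" by linarith
  qed
qed

section \<open>Laurent polynomials on split tori\<close>

text \<open>
  Dedekind's argument by induction on the number of characters.  Subtracting \<open>\<psi> k s\<close> times the
  relation at \<open>t\<close> from the relation at \<open>mul s t\<close> eliminates the character \<open>\<psi> k\<close> and leaves a relation
  among the others; \<open>s\<close> is chosen such that the coefficient of a given \<open>\<psi> j\<close> is multiplied by a
  nonzero number.
\<close>

lemma characters_linearly_independent:
  fixes \<psi> :: "'i \<Rightarrow> 'g \<Rightarrow> 'k::field"
  assumes "finite I" "S \<noteq> {}"
    and mult: "\<And>i s t. i \<in> I \<Longrightarrow> s \<in> S \<Longrightarrow> t \<in> S \<Longrightarrow> mul s t \<in> S \<and> \<psi> i (mul s t) = \<psi> i s * \<psi> i t"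
    and nz: "\<And>i s. i \<in> I \<Longrightarrow> s \<in> S \<Longrightarrow> \<psi> i s \<noteq> 0"
    and dist: "\<And>i j. i \<in> I \<Longrightarrow> j \<in> I \<Longrightarrow> i \<noteq> j \<Longrightarrow> \<exists>s\<in>S. \<psi> i s \<noteq> \<psi> j s"
    and zero: "\<And>s. s \<in> S \<Longrightarrow> (\<Sum>i\<in>I. c i * \<psi> i s) = 0"
    and "i \<in> I"
  shows "c i = 0"
  using assms(1) mult nz dist zero assms(7)
proof (induction I arbitrary: c i rule: finite_induct)
  case (insert k I)
  have cj: "c j = 0" if j: "j \<in> I" for j
  proof -
    obtain s where s: "s \<in> S" "\<psi> j s \<noteq> \<psi> k s"
      using insert.prems(3)[of j k] insert.hyps(2) j by blast
    have "(\<Sum>j\<in>I. (c j * (\<psi> j s - \<psi> k s)) * \<psi> j t) = 0" if t: "t \<in> S" for t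
    proof -
      have "(\<Sum>j\<in>insert k I. c j * \<psi> j (mul s t)) - \<psi> k s * (\<Sum>j\<in>insert k I. c j * \<psi> j t) = 0"
        using insert.prems(1)[OF insertI1 s(1) t] insert.prems(4)[of t] insert.prems(4)[of "mul s t"] t
        by simp
      moreover have "(\<Sum>j\<in>insert k I. c j * \<psi> j (mul s t)) - \<psi> k s * (\<Sum>j\<in>insert k I. c j * \<psi> j t)
          = (\<Sum>j\<in>insert k I. c j * (\<psi> j s - \<psi> k s) * \<psi> j t)"
        unfolding sum_distrib_left sum_subtractf[symmetric]
        using insert.prems(1) s t by (intro sum.cong) (auto simp: algebra_simps)
      ultimately show ?thesis using insert.hyps by simp
    qed
    then have "c j * (\<psi> j s - \<psi> k s) = 0"
      using insert.prems(1-3) j by (intro insert.IH[of "\<lambda>j. c j * (\<psi> j s - \<psi> k s)"]) auto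
    then show ?thesis using s by simp
  qed
  obtain s where s: "s \<in> S" using assms(2) by blast
  have "c k * \<psi> k s = 0" using insert.prems(4)[OF s] insert.hyps cj by simp
  then have "c k = 0" using insert.prems(2) s by simp
  then show ?case using cj insert.prems(5) by auto
qed simp

text \<open>
  The lattice of integral vectors of length \<open>r\<close>.  Padding with zeros, instead of restricting the
  domain, makes it closed under pointwise addition.
\<close>

definition exponents :: "nat \<Rightarrow> (nat \<Rightarrow> int) set" where
  "exponents r = {m. \<forall>i\<ge>r. m i = 0}"

definition monomial :: "nat \<Rightarrow> (nat \<Rightarrow> int) \<Rightarrow> (nat \<Rightarrow> 'k::field) \<Rightarrow> 'k" where
  "monomial r m t = (\<Prod>i<r. t i powi m i)"

definition unit_vec :: "nat \<Rightarrow> nat \<Rightarrow> int" where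
  "unit_vec i = (\<lambda>j. if j = i then 1 else 0)"

lemma Gm_power_nonzero: "t \<in> Gm_power r \<Longrightarrow> i < r \<Longrightarrow> t i \<noteq> 0"
  unfolding Gm_power_def by (auto simp: PiE_iff)

lemma Gm_powerI: "(\<And>i. i < r \<Longrightarrow> f i \<noteq> 0) \<Longrightarrow> (\<lambda>i\<in>{..<r}. f i) \<in> Gm_power r"
  unfolding Gm_power_def by auto

lemma Gm_power_nonempty: "Gm_power r \<noteq> {}"
  using Gm_powerI[of r "\<lambda>_. 1"] by auto

lemma exponents_ext: "m \<in> exponents r \<Longrightarrow> n \<in> exponents r \<Longrightarrow> (\<And>i. i < r \<Longrightarrow> m i = n i) \<Longrightarrow> m = n"
  unfolding exponents_def by (simp add: fun_eq_iff) (metis not_le)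

lemma exponents_add: "m \<in> exponents r \<Longrightarrow> n \<in> exponents r \<Longrightarrow> m + n \<in> exponents r"
  unfolding exponents_def by (simp add: plus_fun_def)

lemma unit_vec_in_exponents: "i < r \<Longrightarrow> unit_vec i \<in> exponents r"
  unfolding exponents_def unit_vec_def by simp

lemma zero_in_exponents: "(\<lambda>_. 0) \<in> exponents r"
  unfolding exponents_def by simp

lemma monomial_nonzero: "t \<in> Gm_power r \<Longrightarrow> monomial r m t \<noteq> 0"
  unfolding monomial_def by (simp add: Gm_power_nonzero)

lemma monomial_add: "t \<in> Gm_power r \<Longrightarrow> monomial r (m + n) t = monomial r m t * monomial r n t"
  unfolding monomial_def by (simp add: plus_fun_def power_int_add Gm_power_nonzero prod.distrib)

lemma monomial_mult:
  "monomial r m (\<lambda>i\<in>{..<r}. s i * t i) = monomial r m s * monomial r m t"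
  unfolding monomial_def by (simp add: power_int_mult_distrib prod.distrib)

lemma monomial_zero: "monomial r (\<lambda>_. 0) t = 1"
  unfolding monomial_def by simp

lemma monomial_unit_vec: "i < r \<Longrightarrow> monomial r (unit_vec i) t = t i"
proof -
  assume "i < r"
  then have "(\<Prod>j<r. t j powi unit_vec i j) = (\<Prod>j<r. if j = i then t i else 1)"
    by (intro prod.cong) (auto simp: unit_vec_def)
  then show ?thesis using \<open>i < r\<close> by (simp add: monomial_def)
qed

lemma monomial_uminus: "monomial r (\<lambda>i. - m i) t = inverse (monomial r m t)"
  unfolding monomial_def by (simp add: power_int_minus prod_inversef[unfolded comp_def])

lemma Gm_power_mult_closed:
  "s \<in> Gm_power r \<Longrightarrow> t \<in> Gm_power r \<Longrightarrow> (\<lambda>i\<in>{..<r}. s i * t i) \<in> Gm_power r"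
  by (rule Gm_powerI) (simp add: Gm_power_nonzero)

text \<open>
  In characteristic zero the element 2 has infinite order, which is all that is needed to recover
  exponents from values on \<open>k\<close>-points.
\<close>

lemma powi_2_inj: "(2::'k::field_char_0) powi m = 2 powi n \<Longrightarrow> m = n"
proof -
  have *: "m = n" if "(2::'k) powi m = 2 powi n" "m \<le> n" for m n
  proof -
    have "(2::'k) powi (n - m) = 1" using that by (simp add: power_int_diff)
    then have "(2::'k) ^ nat (n - m) = 1" using that(2) by (simp add: power_int_def)
    then have "of_nat (2 ^ nat (n - m)) = (of_nat 1 :: 'k)" by simp
    then have "(2::nat) ^ nat (n - m) = 1" by (simp only: of_nat_eq_iff)
    then show ?thesis using that(2) by simp
  qed
  show "(2::'k) powi m = 2 powi n \<Longrightarrow> m = n" using *[of m n] *[of n m] by (cases "m \<le> n") auto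
qed

lemma monomials_distinct:
  assumes "m \<in> exponents r" "n \<in> exponents r" "m \<noteq> n"
  shows "\<exists>t\<in>Gm_power r. monomial r m t \<noteq> (monomial r n t :: 'k::field_char_0)"
proof -
  obtain i where i: "i < r" "m i \<noteq> n i" using assms exponents_ext by blast
  define t where "t = (\<lambda>j\<in>{..<r}. if j = i then 2 else 1 :: 'k)"
  have "monomial r p t = 2 powi p i" for p
  proof -
    have "monomial r p t = (\<Prod>j<r. if j = i then 2 powi p i else 1)"
      unfolding monomial_def t_def by (intro prod.cong) auto
    then show ?thesis using i by simp
  qed
  moreover have "t \<in> Gm_power r" unfolding t_def by (intro Gm_powerI) auto
  ultimately show ?thesis using i(2) powi_2_inj by metis
qed

text \<open>
  The coefficients form a function on all integral vectors with finite support, so that expansions can be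
  compared and combined pointwise.
\<close>

definition laurent_expansion ::
  "nat \<Rightarrow> ((nat \<Rightarrow> 'k::field) \<Rightarrow> 'k) \<Rightarrow> ((nat \<Rightarrow> int) \<Rightarrow> 'k) \<Rightarrow> bool" where
  "laurent_expansion r f c \<longleftrightarrow> finite {m. c m \<noteq> 0} \<and> {m. c m \<noteq> 0} \<subseteq> exponents r \<and>
     (\<forall>t\<in>Gm_power r. f t = (\<Sum>m | c m \<noteq> 0. c m * monomial r m t))"

lemma laurent_expansion_sum:
  assumes "laurent_expansion r f c" "t \<in> Gm_power r" "finite A" "{m. c m \<noteq> 0} \<subseteq> A"
  shows "f t = (\<Sum>m\<in>A. c m * monomial r m t)"
proof -
  have "(\<Sum>m | c m \<noteq> 0. c m * monomial r m t) = (\<Sum>m\<in>A. c m * monomial r m t)"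
    using assms(3,4) by (intro sum.mono_neutral_left) auto
  then show ?thesis using assms(1,2) unfolding laurent_expansion_def by simp
qed

lemma laurent_expansionI:
  assumes "finite A" "{m. c m \<noteq> 0} \<subseteq> A" "A \<subseteq> exponents r"
    and "\<And>t. t \<in> Gm_power r \<Longrightarrow> f t = (\<Sum>m\<in>A. c m * monomial r m t)"
  shows "laurent_expansion r f c"
proof -
  have "(\<Sum>m | c m \<noteq> 0. c m * monomial r m t) = (\<Sum>m\<in>A. c m * monomial r m t)" for t
    using assms(1,2) by (intro sum.mono_neutral_left) auto
  then show ?thesis
    unfolding laurent_expansion_def
    using assms(4) finite_subset[OF assms(2,1)] subset_trans[OF assms(2,3)] by simp
qed

lemma laurent_expansion_cong:
  "laurent_expansion r f c \<Longrightarrow> (\<And>t. t \<in> Gm_power r \<Longrightarrow> g t = f t) \<Longrightarrow> laurent_expansion r g c"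
  unfolding laurent_expansion_def by simp

lemma laurent_expansion_add:
  assumes "laurent_expansion r f c" "laurent_expansion r g d"
  shows "laurent_expansion r (\<lambda>t. f t + g t) (\<lambda>m. c m + d m)"
proof (rule laurent_expansionI)
  let ?A = "{m. c m \<noteq> 0} \<union> {m. d m \<noteq> 0}"
  show fin: "finite ?A" "?A \<subseteq> exponents r" using assms unfolding laurent_expansion_def by auto
  show "f t + g t = (\<Sum>m\<in>?A. (c m + d m) * monomial r m t)" if "t \<in> Gm_power r" for t
    using laurent_expansion_sum[OF assms(1) that fin(1)] laurent_expansion_sum[OF assms(2) that fin(1)]
    by (simp add: distrib_right sum.distrib)
qed auto

lemma laurent_expansion_cmult:
  assumes "laurent_expansion r f c"
  shows "laurent_expansion r (\<lambda>t. a * f t) (\<lambda>m. a * c m)"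
proof (rule laurent_expansionI)
  let ?A = "{m. c m \<noteq> 0}"
  show fin: "finite ?A" "?A \<subseteq> exponents r" using assms unfolding laurent_expansion_def by auto
  show "a * f t = (\<Sum>m\<in>?A. a * c m * monomial r m t)" if "t \<in> Gm_power r" for t
    using laurent_expansion_sum[OF assms that fin(1)] by (simp add: sum_distrib_left mult.assoc)
qed auto

lemma laurent_expansion_monomial:
  assumes "m \<in> exponents r"
  shows "laurent_expansion r (monomial r m) (\<lambda>n. if n = m then 1 else 0)"
  by (rule laurent_expansionI[of "{m}"]) (use assms in auto)

lemma laurent_expansion_zero: "laurent_expansion r (\<lambda>_. 0) (\<lambda>_. 0)"
  by (rule laurent_expansionI[of "{}"]) auto

lemma laurent_expansion_unique:
  fixes f :: "(nat \<Rightarrow> 'k::field_char_0) \<Rightarrow> 'k"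
  assumes "laurent_expansion r f c" "laurent_expansion r f d"
  shows "c = d"
proof
  fix m
  let ?A = "{m. c m \<noteq> 0} \<union> {m. d m \<noteq> 0}"
  have A: "finite ?A" "?A \<subseteq> exponents r" using assms unfolding laurent_expansion_def by auto
  show "c m = d m"
  proof (cases "m \<in> ?A")
    case True
    have "(\<Sum>m\<in>?A. (c m - d m) * monomial r m t) = 0" if "t \<in> Gm_power r" for t
      using laurent_expansion_sum[OF assms(1) that A(1)] laurent_expansion_sum[OF assms(2) that A(1)]
      by (simp add: left_diff_distrib sum_subtractf)
    then have "c m - d m = 0"
      using A(2) True
      by (intro characters_linearly_independent[OF A(1) Gm_power_nonempty[of r],
            where mul = "\<lambda>s t. \<lambda>i\<in>{..<r}. s i * t i" and \<psi> = "monomial r" and c = "\<lambda>m. c m - d m"])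
         (blast intro: Gm_power_mult_closed monomial_mult monomials_distinct dest: monomial_nonzero)+
    then show ?thesis by simp
  qed auto
qed

definition is_laurent :: "nat \<Rightarrow> ((nat \<Rightarrow> 'k::field) \<Rightarrow> 'k) \<Rightarrow> bool" where
  "is_laurent r f \<longleftrightarrow> (\<exists>c. laurent_expansion r f c)"

lemma is_laurentI: "laurent_expansion r f c \<Longrightarrow> is_laurent r f"
  unfolding is_laurent_def by (rule exI[of _ c])

lemma is_laurentE:
  assumes "is_laurent r f" obtains c where "laurent_expansion r f c"
  using assms unfolding is_laurent_def by (elim exE)

lemma is_laurent_cong:
  "is_laurent r f \<Longrightarrow> (\<And>t. t \<in> Gm_power r \<Longrightarrow> g t = f t) \<Longrightarrow> is_laurent r g"
  by (erule is_laurentE, rule is_laurentI, rule laurent_expansion_cong)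

lemma is_laurent_monomial: "m \<in> exponents r \<Longrightarrow> is_laurent r (monomial r m)"
  by (rule is_laurentI[OF laurent_expansion_monomial])

lemma is_laurent_const: "is_laurent r (\<lambda>_. a)"
  by (rule is_laurent_cong[OF is_laurentI[OF laurent_expansion_cmult[OF laurent_expansion_monomial[OF zero_in_exponents], of _ a]]])
     (simp add: monomial_zero)

lemma is_laurent_cmult: "is_laurent r f \<Longrightarrow> is_laurent r (\<lambda>t. a * f t)"
  by (erule is_laurentE, rule is_laurentI, rule laurent_expansion_cmult)

lemma is_laurent_add: "is_laurent r f \<Longrightarrow> is_laurent r g \<Longrightarrow> is_laurent r (\<lambda>t. f t + g t)"
  by (elim is_laurentE, rule is_laurentI, rule laurent_expansion_add)

lemma is_laurent_sum: "(\<And>a. a \<in> A \<Longrightarrow> is_laurent r (f a)) \<Longrightarrow> is_laurent r (\<lambda>t. \<Sum>a\<in>A. f a t)"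
  by (induction A rule: infinite_finite_induct) (auto intro: is_laurent_const is_laurent_add)

lemma is_laurent_mult:
  assumes "is_laurent r f" "is_laurent r g"
  shows "is_laurent r (\<lambda>t. f t * g t)"
proof -
  obtain c d where c: "laurent_expansion r f c" and d: "laurent_expansion r g d"
    using assms by (elim is_laurentE)
  let ?A = "{m. c m \<noteq> 0}" and ?B = "{m. d m \<noteq> 0}"
  have A: "finite ?A" "?A \<subseteq> exponents r" "finite ?B" "?B \<subseteq> exponents r"
    using c d unfolding laurent_expansion_def by auto
  have "is_laurent r (\<lambda>t. \<Sum>p\<in>?A\<times>?B. (c (fst p) * d (snd p)) * monomial r (fst p + snd p) t)"
    using A by (intro is_laurent_sum is_laurent_cmult is_laurent_monomial exponents_add) auto
  then show ?thesis
  proof (rule is_laurent_cong)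
    show "f t * g t = (\<Sum>p\<in>?A\<times>?B. (c (fst p) * d (snd p)) * monomial r (fst p + snd p) t)"
      if t: "t \<in> Gm_power r" for t
      using laurent_expansion_sum[OF c t A(1)] laurent_expansion_sum[OF d t A(3)]
      by (simp add: sum_product sum.cartesian_product monomial_add[OF t] split_def mult_ac)
  qed
qed

lemma is_laurent_coordinate: "i < r \<Longrightarrow> is_laurent r (\<lambda>t. t i)"
  by (rule is_laurent_cong[OF is_laurent_monomial[OF unit_vec_in_exponents[of i]]]) (simp_all add: monomial_unit_vec)

lemma is_laurent_inverse_monomial: "m \<in> exponents r \<Longrightarrow> is_laurent r (\<lambda>t. inverse (monomial r m t))"
  using is_laurent_monomial[of "\<lambda>i. - m i" r] by (simp add: monomial_uminus[symmetric] exponents_def)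

lemma is_laurent_alg_gen:
  assumes "f \<in> alg_gen F" "\<And>g. g \<in> F \<Longrightarrow> is_laurent r (\<lambda>t. g (h t))"
  shows "is_laurent r (\<lambda>t. f (h t))"
  using assms(1)
  by induction (auto intro: assms(2) is_laurent_const is_laurent_add is_laurent_mult)

lemma is_laurent_regular_Gm_power: 
  assumes "f \<in> regular_Gm_power r"
  shows "is_laurent r f"
  using is_laurent_alg_gen[OF assms[unfolded regular_Gm_power_def], of r "\<lambda>t. t"]
    is_laurent_coordinate is_laurent_inverse_monomial[OF unit_vec_in_exponents]
  by (auto simp: monomial_unit_vec)

text \<open>
  For fixed \<open>s\<close>, both \<open>f s * f t\<close> and \<open>f\<close> at the product of \<open>s\<close> and \<open>t\<close> are Laurent polynomials in \<open>t\<close>,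
  with coefficients \<open>f s * c m\<close> and \<open>monomial r m s * c m\<close>.  Comparing them for a single \<open>m\<close> with
  \<open>c m \<noteq> 0\<close> determines \<open>f\<close>.
\<close>

lemma multiplicative_laurent_is_monomial:
  fixes f :: "(nat \<Rightarrow> 'k::field_char_0) \<Rightarrow> 'k"
  assumes laurent: "is_laurent r f"
    and mult: "\<And>s t. s \<in> Gm_power r \<Longrightarrow> t \<in> Gm_power r \<Longrightarrow> f (\<lambda>i\<in>{..<r}. s i * t i) = f s * f t"
    and nz: "\<And>t. t \<in> Gm_power r \<Longrightarrow> f t \<noteq> 0"
  shows "\<exists>m\<in>exponents r. \<forall>t\<in>Gm_power r. f t = monomial r m t"
proof -
  obtain c where exp: "laurent_expansion r f c" using laurent by (rule is_laurentE)
  obtain t0 :: "nat \<Rightarrow> 'k" where t0: "t0 \<in> Gm_power r" using Gm_power_nonempty by blast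
  have fin: "finite {m. c m \<noteq> 0}" and sub: "{m. c m \<noteq> 0} \<subseteq> exponents r"
    using exp unfolding laurent_expansion_def by auto
  obtain m where m: "c m \<noteq> 0"
  proof -
    have "f t0 = (\<Sum>m | c m \<noteq> 0. c m * monomial r m t0)" using exp t0 unfolding laurent_expansion_def by blast
    then have "{m. c m \<noteq> 0} \<noteq> {}" using nz[OF t0] by force
    then show ?thesis using that by blast
  qed
  have "f s = monomial r m s" if s: "s \<in> Gm_power r" for s
  proof -
    have "laurent_expansion r (\<lambda>t. f s * f t) (\<lambda>n. f s * c n)"
      by (rule laurent_expansion_cmult[OF exp])
    moreover have "laurent_expansion r (\<lambda>t. f s * f t) (\<lambda>n. monomial r n s * c n)"
    proof (rule laurent_expansionI[OF fin _ sub])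
      fix t :: "nat \<Rightarrow> 'k" assume t: "t \<in> Gm_power r"
      have "f s * f t = f (\<lambda>i\<in>{..<r}. s i * t i)" using mult s t by simp
      also have "\<dots> = (\<Sum>m | c m \<noteq> 0. c m * monomial r m (\<lambda>i\<in>{..<r}. s i * t i))"
        using exp Gm_power_mult_closed[OF s t] unfolding laurent_expansion_def by blast
      finally show "f s * f t = (\<Sum>m | c m \<noteq> 0. monomial r m s * c m * monomial r m t)"
        by (simp add: monomial_mult mult_ac)
    qed auto
    ultimately have "f s * c m = monomial r m s * c m" using laurent_expansion_unique by metis
    then show ?thesis using m by simp
  qed
  then show ?thesis using m sub by blast
qed

definition torus_hom :: "nat \<Rightarrow> ((nat \<Rightarrow> 'k::field) \<Rightarrow> 'k^'m^'m) \<Rightarrow> bool" where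
  "torus_hom r \<phi> \<longleftrightarrow> (\<forall>t\<in>Gm_power r. \<phi> t \<in> GL) \<and>
     (\<forall>s\<in>Gm_power r. \<forall>t\<in>Gm_power r. \<phi> (\<lambda>i\<in>{..<r}. s i * t i) = \<phi> s ** \<phi> t) \<and>
     (\<forall>a b. \<exists>p \<in> regular_Gm_power r. \<forall>t\<in>Gm_power r. \<phi> t $ a $ b = p t)"

lemma alg_gen_sum: "(\<And>a. a \<in> A \<Longrightarrow> f a \<in> alg_gen F) \<Longrightarrow> (\<lambda>p. \<Sum>a\<in>A. f a p) \<in> alg_gen F"
  by (induction A rule: infinite_finite_induct) (auto intro: alg_gen.intros)

lemma alg_gen_prod: "(\<And>a. a \<in> A \<Longrightarrow> f a \<in> alg_gen F) \<Longrightarrow> (\<lambda>p. \<Prod>a\<in>A. f a p) \<in> alg_gen F"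
  by (induction A rule: infinite_finite_induct) (auto intro: alg_gen.intros)

lemma alg_gen_det:
  "(\<And>i j. (\<lambda>p. M p $ i $ j) \<in> alg_gen F) \<Longrightarrow> (\<lambda>p. det (M p)) \<in> alg_gen F"
  unfolding det_def by (intro alg_gen_sum alg_gen.mult alg_gen_prod alg_gen.const)

lemma alg_gen_compose:
  assumes "f \<in> alg_gen F" "\<And>g. g \<in> F \<Longrightarrow> (\<lambda>p. g (h p)) \<in> alg_gen F'"
  shows "(\<lambda>p. f (h p)) \<in> alg_gen F'"
  using assms(1) by induction (auto intro: alg_gen.intros assms(2))

text \<open>
  The determinant along a homomorphism is multiplicative and nowhere zero, hence a monomial.  This takes
  care of the inverse determinant among the generators of the regular functions.
\<close>

lemma torus_hom_laurent:
  fixes \<phi> :: "(nat \<Rightarrow> 'k::field_char_0) \<Rightarrow> 'k^'m^'m"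
  assumes hom: "torus_hom r \<phi>" and f: "f \<in> regular_GL"
  shows "is_laurent r (\<lambda>t. f (\<phi> t))"
proof -
  obtain p where p: "\<And>a b. p a b \<in> regular_Gm_power r"
    "\<And>a b t. t \<in> Gm_power r \<Longrightarrow> \<phi> t $ a $ b = p a b t"
    using hom unfolding torus_hom_def by metis
  have entry: "is_laurent r (\<lambda>t. \<phi> t $ a $ b)" for a b
    by (rule is_laurent_cong[OF is_laurent_regular_Gm_power[OF p(1)[of a b]] p(2)])
  have "is_laurent r (\<lambda>t. det (\<phi> t))"
  proof -
    have "(\<lambda>g. det g) \<in> alg_gen {\<lambda>g :: 'k^'m^'m. g $ i $ j | i j. True}"
      by (intro alg_gen_det alg_gen.gen) blast
    then show ?thesis
      by (rule is_laurent_alg_gen) (auto intro: entry)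
  qed
  then obtain m where m: "m \<in> exponents r" "\<And>t. t \<in> Gm_power r \<Longrightarrow> det (\<phi> t) = monomial r m t"
    using multiplicative_laurent_is_monomial[of r "\<lambda>t. det (\<phi> t)"] hom
    unfolding torus_hom_def GL_def by (simp add: det_mul invertible_det_nz) metis
  have "is_laurent r (\<lambda>t. inverse (det (\<phi> t)))"
    by (rule is_laurent_cong[OF is_laurent_inverse_monomial[OF m(1)]]) (simp add: m(2))
  then show ?thesis
    using f unfolding regular_GL_def by (elim is_laurent_alg_gen) (auto intro: entry)
qed

section \<open>Characters and cocharacters of a split torus\<close>

lemma matrix_inv_inverse:
  assumes "g \<in> GL" shows "g ** matrix_inv g = mat 1" "matrix_inv g ** g = mat 1"
proof -
  have "\<exists>h. g ** h = mat 1 \<and> h ** g = mat 1" using assms unfolding GL_def invertible_def by simp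
  then have "g ** matrix_inv g = mat 1 \<and> matrix_inv g ** g = mat 1"
    unfolding matrix_inv_def by (rule someI_ex)
  then show "g ** matrix_inv g = mat 1" "matrix_inv g ** g = mat 1" by auto
qed

lemma matrix_inv_unique:
  assumes "g ** h = mat 1" "g \<in> GL" shows "matrix_inv g = h"
proof -
  have "matrix_inv g = matrix_inv g ** (g ** h)" using assms(1) by simp
  also have "\<dots> = h" using matrix_inv_inverse(2)[OF assms(2)] by (simp add: matrix_mul_assoc)
  finally show ?thesis .
qed

text \<open>
  Cramer's rule for the columns of the inverse; it shows that inversion is a regular map.
\<close>

lemma matrix_inv_entry:
  fixes g :: "'k::field^'m^'m"
  assumes "g \<in> GL"
  shows "matrix_inv g $ k $ l = det (\<chi> i j. if j = k then axis l 1 $ i else g $ i $ j) * inverse (det g)"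
proof -
  have "det g \<noteq> 0" using assms unfolding GL_def by (simp add: invertible_det_nz)
  moreover have "g *v (matrix_inv g *v axis l 1) = axis l 1"
    by (simp add: matrix_vector_mul_assoc matrix_inv_inverse(1)[OF assms])
  ultimately have "matrix_inv g *v axis l 1 =
      (\<chi> k. det (\<chi> i j. if j = k then axis l 1 $ i else g $ i $ j) / det g)"
    using cramer by blast
  moreover have "(matrix_inv g *v axis l 1) $ k = matrix_inv g $ k $ l"
    by (simp add: matrix_vector_mult_def axis_def if_distrib sum.delta cong: if_cong)
  ultimately show ?thesis by (simp add: divide_inverse)
qed

lemma regular_GL_entry: "(\<lambda>g. g $ a $ b) \<in> regular_GL"
  unfolding regular_GL_def by (rule alg_gen.gen) blast

lemma regular_GL_compose_inverse:
  fixes p :: "'k::field^'m^'m \<Rightarrow> 'k"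
  assumes "p \<in> regular_GL"
  shows "\<exists>q\<in>regular_GL. \<forall>g\<in>GL. p (matrix_inv g) = q g"
  using assms unfolding regular_GL_def
proof (induction rule: alg_gen.induct)
  let ?F = "{\<lambda>g. g $ i $ j | i j. True} \<union> {\<lambda>g. inverse (det g)} :: ('k^'m^'m \<Rightarrow> 'k) set"
  case (gen f)
  then consider a b where "f = (\<lambda>g. g $ a $ b)" | "f = (\<lambda>g. inverse (det g))" by auto
  then show ?case
  proof cases
    case 1
    have "(\<lambda>g. det (\<chi> i j. if j = a then axis b 1 $ i else g $ i $ j)) \<in> alg_gen ?F"
    proof (rule alg_gen_det)
      fix i j
      show "(\<lambda>g. (\<chi> i j. if j = a then axis b 1 $ i else g $ i $ j) $ i $ j) \<in> alg_gen ?F"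
        using regular_GL_entry[of i j] by (cases "j = a") (auto simp: regular_GL_def intro: alg_gen.const)
    qed
    then have "(\<lambda>g. det (\<chi> i j. if j = a then axis b 1 $ i else g $ i $ j) * inverse (det g)) \<in> alg_gen ?F"
      by (rule alg_gen.mult) (simp add: alg_gen.gen)
    then show ?thesis
      unfolding 1 by (rule bexI[rotated]) (intro ballI matrix_inv_entry)
  next
    case 2
    have "inverse (det (matrix_inv g)) = det g" if "g \<in> GL" for g :: "'k^'m^'m"
    proof -
      have "det g * det (matrix_inv g) = 1"
        using det_mul[of g "matrix_inv g"] matrix_inv_inverse(1)[OF that] by simp
      then show ?thesis by (metis inverse_unique mult.commute)
    qed
    moreover have "(\<lambda>g. det g) \<in> alg_gen ?F"
      using regular_GL_entry unfolding regular_GL_def by (intro alg_gen_det)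
    ultimately show ?thesis using 2 by blast
  qed
next
  case (const c)
  show ?case by (rule bexI[OF _ alg_gen.const[of c]]) simp
next
  case (add f g)
  then obtain p q where p: "p \<in> alg_gen ({\<lambda>g. g $ i $ j | i j. True} \<union> {\<lambda>g. inverse (det g)})"
     "q \<in> alg_gen ({\<lambda>g. g $ i $ j | i j. True} \<union> {\<lambda>g. inverse (det g)})"
     "\<forall>h\<in>GL. f (matrix_inv h) = p h" "\<forall>h\<in>GL. g (matrix_inv h) = q h" by blast
  show ?case using p(3,4) by (intro bexI[OF _ alg_gen.add[OF p(1,2)]]) simp
next
  case (mult f g)
  then obtain p q where p: "p \<in> alg_gen ({\<lambda>g. g $ i $ j | i j. True} \<union> {\<lambda>g. inverse (det g)})"
     "q \<in> alg_gen ({\<lambda>g. g $ i $ j | i j. True} \<union> {\<lambda>g. inverse (det g)})"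
     "\<forall>h\<in>GL. f (matrix_inv h) = p h" "\<forall>h\<in>GL. g (matrix_inv h) = q h" by blast
  show ?case using p(3,4) by (intro bexI[OF _ alg_gen.mult[OF p(1,2)]]) simp
qed

lemma regular_on_const: "regular_on S (\<lambda>_. c)"
  unfolding regular_on_def regular_GL_def by (rule bexI[OF _ alg_gen.const[of c]]) simp

lemma regular_on_mult: 
  assumes "regular_on S f" "regular_on S g"
  shows "regular_on S (\<lambda>x. f x * g x)"
proof -
  obtain p q where p: "p \<in> regular_GL" "q \<in> regular_GL" "\<forall>x\<in>S. f x = p x" "\<forall>x\<in>S. g x = q x"
    using assms unfolding regular_on_def by blast
  have "(\<lambda>x. p x * q x) \<in> regular_GL" using p(1,2) unfolding regular_GL_def by (rule alg_gen.mult)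
  then show ?thesis unfolding regular_on_def using p(3,4) by (intro bexI[of _ "\<lambda>x. p x * q x"]) simp_all
qed

lemma regular_on_prod: "(\<And>a. a \<in> A \<Longrightarrow> regular_on S (f a)) \<Longrightarrow> regular_on S (\<lambda>x. \<Prod>a\<in>A. f a x)"
  by (induction A rule: infinite_finite_induct) (auto intro: regular_on_const regular_on_mult)

lemma regular_on_cong: "regular_on S f \<Longrightarrow> (\<And>x. x \<in> S \<Longrightarrow> g x = f x) \<Longrightarrow> regular_on S g"
  unfolding regular_on_def by auto

lemma regular_on_power: "regular_on S f \<Longrightarrow> regular_on S (\<lambda>x. f x ^ n)"
  by (induction n) (auto intro: regular_on_const regular_on_mult)

lemma alg_gen_power: "f \<in> alg_gen F \<Longrightarrow> (\<lambda>x. f x ^ n) \<in> alg_gen F"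
  by (induction n) (auto intro: alg_gen.intros)

lemma regular_Gm_powi: "(\<lambda>s. s powi n) \<in> regular_Gm"
  unfolding regular_Gm_def power_int_def
  by (cases "0 \<le> n")
    (use alg_gen_power[OF alg_gen.gen[of "\<lambda>t. t" "{\<lambda>t. t, inverse}"], of "nat n"]
    alg_gen_power[OF alg_gen.gen[of inverse "{\<lambda>t. t, inverse}"], of "nat (- n)"]
     in simp_all)

lemma cocharacter_torus_hom:
  assumes "\<gamma> \<in> cocharacters T" "T \<subseteq> GL"
  shows "torus_hom 1 (\<lambda>t. \<gamma> (t 0))"
  unfolding torus_hom_def
proof (intro conjI ballI allI)
  fix t :: "nat \<Rightarrow> 'a" assume t: "t \<in> Gm_power 1"
  have nz: "t 0 \<noteq> 0" using Gm_power_nonzero[OF t] by simp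
  then show "\<gamma> (t 0) \<in> GL" using assms unfolding cocharacters_def by blast
  fix s :: "nat \<Rightarrow> 'a" assume s: "s \<in> Gm_power 1"
  show "\<gamma> ((\<lambda>i\<in>{..<1}. s i * t i) 0) = \<gamma> (s 0) ** \<gamma> (t 0)"
    using assms(1) nz Gm_power_nonzero[OF s, of 0] unfolding cocharacters_def by simp
next
  fix a b
  have "\<exists>p\<in>regular_Gm. \<forall>s. s \<noteq> 0 \<longrightarrow> \<gamma> s $ a $ b = p s"
    using assms(1) unfolding cocharacters_def by simp
  then obtain p where p: "p \<in> regular_Gm" "\<forall>s. s \<noteq> 0 \<longrightarrow> \<gamma> s $ a $ b = p s"
    by (elim bexE)
  have "(\<lambda>t. p (t 0)) \<in> regular_Gm_power 1"
    unfolding regular_Gm_power_def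
    by (rule alg_gen_compose[OF p(1)[unfolded regular_Gm_def]]) (auto intro!: alg_gen.gen)
  then show "\<exists>p\<in>regular_Gm_power 1. \<forall>t\<in>Gm_power 1. \<gamma> (t 0) $ a $ b = p t"
    using p(2) Gm_power_nonzero[of _ 1 0] by (intro bexI[of _ "\<lambda>t. p (t 0)"] ballI) auto
qed

text \<open>
  The composition of a character with a cocharacter is a multiplicative Laurent polynomial in one
  variable, so the description defining the pairing does apply to exactly one integer.
\<close>

lemma character_cocharacter:
  fixes \<eta> :: "'k::field_char_0^'m^'m \<Rightarrow> 'k"
  assumes "\<gamma> \<in> cocharacters T" "T \<subseteq> GL" "\<eta> \<in> characters T"
  shows "\<forall>s. s \<noteq> 0 \<longrightarrow> \<eta> (\<gamma> s) = s powi pairing \<gamma> \<eta>"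
proof -
  have inT: "\<gamma> (t 0) \<in> T" if "t \<in> Gm_power 1" for t
    using assms(1) Gm_power_nonzero[OF that, of 0] unfolding cocharacters_def by simp
  obtain p where p: "p \<in> regular_GL" "\<forall>g\<in>T. \<eta> g = p g"
    using assms(3) unfolding characters_def regular_on_def by blast
  have "is_laurent 1 (\<lambda>t. \<eta> (\<gamma> (t 0)))"
    by (rule is_laurent_cong[OF torus_hom_laurent[OF cocharacter_torus_hom[OF assms(1,2)] p(1)]])
       (simp add: p(2) inT)
  moreover have "\<eta> (\<gamma> ((\<lambda>i\<in>{..<1}. s i * t i) 0)) = \<eta> (\<gamma> (s 0)) * \<eta> (\<gamma> (t 0))"
    if "s \<in> Gm_power 1" "t \<in> Gm_power 1" for s t
    using assms(1,3) inT[OF that(1)] inT[OF that(2)] Gm_power_nonzero[OF that(1), of 0] Gm_power_nonzero[OF that(2), of 0]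
    unfolding cocharacters_def characters_def by simp
  moreover have "\<eta> (\<gamma> (t 0)) \<noteq> 0" if "t \<in> Gm_power 1" for t
    using assms(3) inT[OF that] unfolding characters_def by simp
  ultimately obtain m where m: "\<And>t. t \<in> Gm_power 1 \<Longrightarrow> \<eta> (\<gamma> (t 0)) = monomial 1 m t"
    using multiplicative_laurent_is_monomial[of 1 "\<lambda>t. \<eta> (\<gamma> (t 0))"] by blast
  have ex: "\<forall>s. s \<noteq> 0 \<longrightarrow> \<eta> (\<gamma> s) = s powi m 0"
  proof clarify
    fix s :: 'k assume "s \<noteq> 0"
    then have "(\<lambda>i\<in>{..<1}. s) \<in> Gm_power 1" by (intro Gm_powerI)
    from m[OF this] show "\<eta> (\<gamma> s) = s powi m 0" by (simp add: monomial_def)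
  qed
  show ?thesis
    unfolding pairing_def
  proof (rule theI[where P = "\<lambda>n. \<forall>s. s \<noteq> 0 \<longrightarrow> \<eta> (\<gamma> s) = s powi n", OF ex])
    fix n assume "\<forall>s. s \<noteq> 0 \<longrightarrow> \<eta> (\<gamma> s) = s powi n"
    then have "(2::'k) powi n = 2 powi m 0" using ex by (metis zero_neq_numeral)
    then show "n = m 0" by (rule powi_2_inj)
  qed
qed

lemma pairing_eqI:
  fixes \<eta> :: "'k::field_char_0^'m^'m \<Rightarrow> 'k"
  assumes "\<And>s. s \<noteq> 0 \<Longrightarrow> \<eta> (\<gamma> s) = s powi n"
  shows "pairing \<gamma> \<eta> = n"
  unfolding pairing_def
proof (rule the_equality)
  fix m assume "\<forall>s. s \<noteq> 0 \<longrightarrow> \<eta> (\<gamma> s) = s powi m"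
  then have "(2::'k) powi m = 2 powi n" using assms by (metis zero_neq_numeral)
  then show "m = n" by (rule powi_2_inj)
qed (use assms in blast)

text \<open>
  A split torus together with an isomorphism from a power of the multiplicative group, which serves to
  write its characters and cocharacters as integral vectors.
\<close>

locale split_torus_chart =
  fixes T :: "('k::field_char_0^'m^'m) set" and r :: nat and \<theta> :: "(nat \<Rightarrow> 'k) \<Rightarrow> 'k^'m^'m"
  assumes alg: "algebraic_group T"
    and bij: "bij_betw \<theta> (Gm_power r) T"
    and hom: "\<forall>s\<in>Gm_power r. \<forall>t\<in>Gm_power r. \<theta> (\<lambda>i\<in>{..<r}. s i * t i) = \<theta> s ** \<theta> t"
    and regular: "\<forall>a b. \<exists>p \<in> regular_Gm_power r. \<forall>t\<in>Gm_power r. \<theta> t $ a $ b = p t"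
    and coord_regular: "\<forall>i<r. regular_on T (\<lambda>g. inv_into (Gm_power r) \<theta> g i)"

lemma split_torus_chart_exists:
  "split_torus T \<Longrightarrow> \<exists>r \<theta>. split_torus_chart T r \<theta>"
  unfolding split_torus_def split_torus_chart_def by blast

context split_torus_chart
begin

definition coord :: "'k^'m^'m \<Rightarrow> nat \<Rightarrow> 'k" where "coord g = inv_into (Gm_power r) \<theta> g"

definition char_of :: "(nat \<Rightarrow> int) \<Rightarrow> 'k^'m^'m \<Rightarrow> 'k" where
  "char_of m = (\<lambda>g\<in>T. monomial r m (coord g))"

definition cochar :: "(nat \<Rightarrow> int) \<Rightarrow> 'k \<Rightarrow> 'k^'m^'m" where
  "cochar n s = \<theta> (\<lambda>i\<in>{..<r}. s powi n i)"

lemma T_GL: "T \<subseteq> GL"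
  using alg unfolding algebraic_group_def closed_GL_def by auto

lemma theta_in_T: "t \<in> Gm_power r \<Longrightarrow> \<theta> t \<in> T"
  using bij bij_betwE by blast

lemma coord_theta: "t \<in> Gm_power r \<Longrightarrow> coord (\<theta> t) = t"
  unfolding coord_def using bij by (simp add: bij_betw_def)

lemma theta_coord: "g \<in> T \<Longrightarrow> \<theta> (coord g) = g"
  unfolding coord_def using bij by (simp add: bij_betw_def f_inv_into_f)

lemma coord_in: "g \<in> T \<Longrightarrow> coord g \<in> Gm_power r"
  unfolding coord_def using bij by (metis bij_betw_def inv_into_into)

lemma coord_mult:
  assumes "g \<in> T" "h \<in> T" shows "coord (g ** h) = (\<lambda>i\<in>{..<r}. coord g i * coord h i)"
proof -
  have "\<theta> (\<lambda>i\<in>{..<r}. coord g i * coord h i) = g ** h"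
    using hom coord_in[OF assms(1)] coord_in[OF assms(2)] theta_coord assms by simp
  then show ?thesis
    using coord_theta[OF Gm_power_mult_closed[OF coord_in[OF assms(1)] coord_in[OF assms(2)]]] by simp
qed

lemma mult_in_T: "g \<in> T \<Longrightarrow> h \<in> T \<Longrightarrow> g ** h \<in> T"
  and inv_in_T: "g \<in> T \<Longrightarrow> matrix_inv g \<in> T"
  and one_in_T: "mat 1 \<in> T"
  using alg unfolding algebraic_group_def by auto

lemma torus_hom_theta: "torus_hom r \<theta>"
  unfolding torus_hom_def using T_GL theta_in_T hom regular by blast

lemma T_commute:
  assumes "g \<in> T" "h \<in> T" shows "g ** h = h ** g"
proof -
  have "coord (g ** h) = coord (h ** g)"
    using assms by (simp add: coord_mult mult.commute)
  then show ?thesis using theta_coord mult_in_T assms by metis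
qed

lemma inv_mult:
  assumes "g \<in> T" "h \<in> T" shows "matrix_inv (g ** h) = matrix_inv g ** matrix_inv h"
proof (rule matrix_inv_unique)
  have GL: "g \<in> GL" "h \<in> GL" "g ** h \<in> GL" using assms mult_in_T T_GL by auto
  show "g ** h \<in> GL" by fact
  have "(g ** h) ** (matrix_inv g ** matrix_inv h) = (h ** g) ** (matrix_inv g ** matrix_inv h)"
    using T_commute assms by simp
  also have "\<dots> = h ** (g ** matrix_inv g) ** matrix_inv h" by (simp add: matrix_mul_assoc)
  finally show "(g ** h) ** (matrix_inv g ** matrix_inv h) = mat 1"
    by (simp add: matrix_inv_inverse(1)[OF GL(1)] matrix_inv_inverse(1)[OF GL(2)])
qed

lemma inv_inv: "g \<in> T \<Longrightarrow> matrix_inv (matrix_inv g) = g"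
  using matrix_inv_unique matrix_inv_inverse(2) inv_in_T T_GL by blast

lemma char_of_theta: "t \<in> Gm_power r \<Longrightarrow> char_of m (\<theta> t) = monomial r m t"
  unfolding char_of_def by (simp add: theta_in_T coord_theta)

lemma char_of_mult: "g \<in> T \<Longrightarrow> h \<in> T \<Longrightarrow> char_of m (g ** h) = char_of m g * char_of m h"
  unfolding char_of_def by (simp add: mult_in_T coord_mult monomial_mult)

lemma char_of_nonzero: "g \<in> T \<Longrightarrow> char_of m g \<noteq> 0"
  unfolding char_of_def by (simp add: monomial_nonzero coord_in)

lemma char_of_one: "char_of m (mat 1) = 1"
  using char_of_mult[OF one_in_T one_in_T, of m] char_of_nonzero[OF one_in_T] by simp

lemma char_of_inv: 
  assumes "g \<in> T" shows "char_of m (matrix_inv g) = inverse (char_of m g)"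
proof -
  have "char_of m g * char_of m (matrix_inv g) = 1"
    using char_of_mult[OF assms inv_in_T[OF assms], of m] matrix_inv_inverse(1)[of g] char_of_one T_GL assms
    by auto
  then show ?thesis by (metis inverse_unique)
qed

lemma regular_on_inv:
  assumes "regular_on T f" shows "regular_on T (\<lambda>g. f (matrix_inv g))"
proof -
  obtain p where p: "p \<in> regular_GL" "\<forall>g\<in>T. f g = p g" using assms unfolding regular_on_def by blast
  then obtain q where q: "q \<in> regular_GL" "\<forall>g\<in>GL. p (matrix_inv g) = q g"
    using regular_GL_compose_inverse by blast
  show ?thesis unfolding regular_on_def
    using p(2) q inv_in_T T_GL by (intro bexI[OF _ q(1)]) auto
qed

lemma regular_on_laurent: "regular_on T f \<Longrightarrow> is_laurent r (\<lambda>t. f (\<theta> t))"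
  unfolding regular_on_def using torus_hom_laurent[OF torus_hom_theta] theta_in_T
  by (auto intro: is_laurent_cong)

lemma coord_inv: 
  assumes "g \<in> T" "i < r" shows "coord (matrix_inv g) i = inverse (coord g i)"
  using char_of_inv[OF assms(1), of "unit_vec i"] assms inv_in_T
  by (simp add: char_of_def monomial_unit_vec)

text \<open>
  Negative powers of a coordinate are positive powers of the coordinate of the inverse group element.
\<close>

lemma char_of_regular: "regular_on T (char_of m)"
proof (rule regular_on_cong)
  have reg: "regular_on T (\<lambda>g. coord g i)" if "i < r" for i
    using coord_regular that unfolding coord_def by blast
  have "regular_on T (\<lambda>g. coord g i powi m i)" if "i < r" for i
  proof (cases "m i \<ge> 0")
    case True
    then show ?thesis unfolding power_int_def using regular_on_power[OF reg[OF that]] by simp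
  next
    case False
    have "regular_on T (\<lambda>g. coord (matrix_inv g) i ^ nat (- m i))"
      by (intro regular_on_power regular_on_inv reg that)
    then show ?thesis
      by (rule regular_on_cong) (use False in \<open>simp add: power_int_def coord_inv that\<close>)
  qed
  then show "regular_on T (\<lambda>g. \<Prod>i<r. coord g i powi m i)" by (intro regular_on_prod) simp
  show "char_of m g = (\<Prod>i<r. coord g i powi m i)" if "g \<in> T" for g
    using that by (simp add: char_of_def monomial_def)
qed

lemma char_of_in_characters: "char_of m \<in> characters T"
  unfolding characters_def
  using char_of_regular char_of_nonzero char_of_mult by (auto simp: char_of_def)

text \<open>
  Pulled back along the chart, a character is a multiplicative Laurent polynomial, hence a monomial.
\<close>

lemma characters_eq: "characters T = char_of ` exponents r"
proof (rule antisym; rule subsetI)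
  fix \<eta> assume \<eta>: "\<eta> \<in> characters T"
  have "is_laurent r (\<lambda>t. \<eta> (\<theta> t))"
    using \<eta> unfolding characters_def by (intro regular_on_laurent) simp
  then obtain m where m: "m \<in> exponents r" "\<And>t. t \<in> Gm_power r \<Longrightarrow> \<eta> (\<theta> t) = monomial r m t"
    using multiplicative_laurent_is_monomial[of r "\<lambda>t. \<eta> (\<theta> t)"] \<eta> hom theta_in_T
    unfolding characters_def by auto
  have "\<eta> = char_of m"
  proof (rule extensionalityI)
    show "\<eta> \<in> extensional T" "char_of m \<in> extensional T"
      using \<eta> by (auto simp: characters_def char_of_def)
    show "\<eta> g = char_of m g" if "g \<in> T" for g
      using m(2)[OF coord_in[OF that]] that by (simp add: theta_coord char_of_def)
  qed
  then show "\<eta> \<in> char_of ` exponents r" using m(1) by blast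
qed (auto simp: char_of_in_characters)

lemma char_of_inj: "m \<in> exponents r \<Longrightarrow> n \<in> exponents r \<Longrightarrow> char_of m = char_of n \<Longrightarrow> m = n"
  using monomials_distinct[of m r n, where 'k = 'k] char_of_theta by metis

lemma char_mult_char_of: "char_mult T (char_of m) (char_of n) = char_of (m + n)"
  unfolding char_mult_def char_of_def by (auto simp: fun_eq_iff monomial_add coord_in)

lemma cochar_arg: "s \<noteq> 0 \<Longrightarrow> (\<lambda>i\<in>{..<r}. s powi n i) \<in> Gm_power r" for s :: 'k
  by (intro Gm_powerI) simp

lemma cochar_in_T: "s \<noteq> 0 \<Longrightarrow> cochar n s \<in> T"
  unfolding cochar_def by (intro theta_in_T cochar_arg)

lemma cochar_in_cocharacters: "cochar n \<in> cocharacters T"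
  unfolding cocharacters_def
proof (intro CollectI conjI allI impI)
  fix s s' :: 'k assume s: "s \<noteq> 0" "s' \<noteq> 0"
  show "cochar n s \<in> T" by (rule cochar_in_T[OF s(1)])
  have "(\<lambda>i\<in>{..<r}. (s * s') powi n i) =
      (\<lambda>i\<in>{..<r}. (\<lambda>i\<in>{..<r}. s powi n i) i * (\<lambda>i\<in>{..<r}. s' powi n i) i)"
    by (auto simp: power_int_mult_distrib)
  then show "cochar n (s * s') = cochar n s ** cochar n s'"
    unfolding cochar_def using hom cochar_arg s by metis
next
  fix a b
  obtain p where p: "p \<in> regular_Gm_power r" "\<forall>t\<in>Gm_power r. \<theta> t $ a $ b = p t"
    using regular by blast
  have "(\<lambda>s. p (\<lambda>i\<in>{..<r}. s powi n i)) \<in> regular_Gm"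
    unfolding regular_Gm_def
  proof (rule alg_gen_compose[OF p(1)[unfolded regular_Gm_power_def]])
    fix g :: "(nat \<Rightarrow> 'k) \<Rightarrow> 'k"
    assume "g \<in> {\<lambda>t. t i | i. i < r} \<union> {\<lambda>t. inverse (t i) | i. i < r}"
    then obtain i where i: "i < r" and g: "g = (\<lambda>t. t i) \<or> g = (\<lambda>t. inverse (t i))" by blast
    have "(\<lambda>s. s powi n i) \<in> alg_gen {\<lambda>t :: 'k. t, inverse}" "(\<lambda>s. s powi (- n i)) \<in> alg_gen {\<lambda>t :: 'k. t, inverse}"
      using regular_Gm_powi[unfolded regular_Gm_def] by auto
    then show "(\<lambda>s. g (\<lambda>i\<in>{..<r}. s powi n i)) \<in> alg_gen {\<lambda>t. t, inverse}"
      using g i by (auto simp: power_int_minus)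
  qed
  then show "\<exists>p\<in>regular_Gm. \<forall>s. s \<noteq> 0 \<longrightarrow> cochar n s $ a $ b = p s"
    using p(2) cochar_arg unfolding cochar_def by (intro bexI[of _ "\<lambda>s. p (\<lambda>i\<in>{..<r}. s powi n i)"]) auto
qed

lemma char_of_cochar: 
  assumes "s \<noteq> 0" shows "char_of m (cochar n s) = s powi (\<Sum>i<r. n i * m i)"
proof -
  have *: "s powi (\<Sum>i\<in>A. f i) = (\<Prod>i\<in>A. s powi f i)" for A and f :: "nat \<Rightarrow> int"
    using assms by (induction A rule: infinite_finite_induct) (auto simp: power_int_add)
  show ?thesis
    unfolding cochar_def char_of_theta[OF cochar_arg[OF assms]] monomial_def *
    by (intro prod.cong) (auto simp: power_int_mult)
qed

lemma pairing_cochar: "pairing (cochar n) (char_of m) = (\<Sum>i<r. n i * m i)"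
  by (rule pairing_eqI) (rule char_of_cochar)

lemma pairing_char_mult:
  assumes "\<gamma> \<in> cocharacters T" "\<eta> \<in> characters T" "\<psi> \<in> characters T"
  shows "pairing \<gamma> (char_mult T \<eta> \<psi>) = pairing \<gamma> \<eta> + pairing \<gamma> \<psi>"
proof (rule pairing_eqI)
  fix s :: 'k assume s: "s \<noteq> 0"
  then have "\<gamma> s \<in> T" using assms(1) unfolding cocharacters_def by simp
  then show "char_mult T \<eta> \<psi> (\<gamma> s) = s powi (pairing \<gamma> \<eta> + pairing \<gamma> \<psi>)"
    using character_cocharacter[OF assms(1) T_GL assms(2)] character_cocharacter[OF assms(1) T_GL assms(3)] s
    by (simp add: char_mult_def power_int_add)
qed

end

section \<open>The real span of the character lattice\<close>

locale weight_lattice = split_torus_chart T r \<theta>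
  for T :: "('k::field_char_0^'m^'m) set" and r \<theta> +
  fixes V :: "'v::euclidean_space set" and \<iota> :: "('k^'m^'m \<Rightarrow> 'k) \<Rightarrow> 'v"
  assumes ext: "real_extension T V \<iota>"
begin

definition weight_vec :: "(nat \<Rightarrow> int) \<Rightarrow> 'v" where "weight_vec m = \<iota> (char_of m)"

lemma additive_extension:
  fixes f :: "('k^'m^'m \<Rightarrow> 'k) \<Rightarrow> real"
  assumes "\<And>\<eta> \<psi>. \<eta> \<in> characters T \<Longrightarrow> \<psi> \<in> characters T \<Longrightarrow> f (char_mult T \<eta> \<psi>) = f \<eta> + f \<psi>"
  shows "\<exists>h :: 'v \<Rightarrow> real. linear h \<and> (\<forall>\<eta>\<in>characters T. h (\<iota> \<eta>) = f \<eta>)"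
  using ext[unfolded real_extension_def, THEN conjunct2, THEN conjunct2, rule_format, of f] assms by simp

lemma weight_vec_add: "weight_vec (m + n) = weight_vec m + weight_vec n"
  using ext char_of_in_characters unfolding real_extension_def weight_vec_def char_mult_char_of[symmetric] by blast

lemma weight_vec_zero: "weight_vec 0 = 0"
  using weight_vec_add[of 0 0] by simp

lemma weight_vec_cmult: "weight_vec (\<lambda>j. k * m j) = of_int k *\<^sub>R weight_vec m"
proof -
  have nat: "weight_vec (\<lambda>j. int n * m j) = of_nat n *\<^sub>R weight_vec m" for n and m
  proof (induction n)
    case 0
    then show ?case using weight_vec_zero by (simp add: zero_fun_def)
  next
    case (Suc n)
    have "(\<lambda>j. int (Suc n) * m j) = m + (\<lambda>j. int n * m j)"
      by (simp add: fun_eq_iff algebra_simps)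
    then show ?case using Suc by (simp add: weight_vec_add algebra_simps)
  qed
  have neg: "weight_vec (\<lambda>j. - m j) = - weight_vec m" for m
  proof -
    have "weight_vec m + weight_vec (\<lambda>j. - m j) = weight_vec (m + (\<lambda>j. - m j))" by (simp add: weight_vec_add)
    also have "m + (\<lambda>j. - m j) = 0" by (simp add: fun_eq_iff)
    finally show ?thesis unfolding weight_vec_zero by (simp add: eq_neg_iff_add_eq_0 add.commute)
  qed
  show ?thesis
  proof (cases "k \<ge> 0")
    case True
    then show ?thesis using nat[of "nat k" m] by simp
  next
    case False
    have "weight_vec (\<lambda>j. k * m j) = weight_vec (\<lambda>j. int (nat (- k)) * - m j)" using False by simp
    then show ?thesis using False nat[of "nat (- k)" "\<lambda>j. - m j"] neg[of m] by simp
  qed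
qed

text \<open>
  The vectors of the coordinate characters generate: additivity gives the expansion of the first \<open>n\<close>
  exponents by induction on \<open>n\<close>.
\<close>

lemma weight_vec_eq_sum:
  assumes "m \<in> exponents r"
  shows "weight_vec m = (\<Sum>i<r. of_int (m i) *\<^sub>R weight_vec (unit_vec i))"
proof -
  have "weight_vec (\<lambda>j. if j < n then m j else 0) = (\<Sum>i<n. of_int (m i) *\<^sub>R weight_vec (unit_vec i))" for n
  proof (induction n)
    case 0
    then show ?case using weight_vec_zero by (simp add: zero_fun_def)
  next
    case (Suc n)
    have "(\<lambda>j. if j < Suc n then m j else 0) = (\<lambda>j. if j < n then m j else 0) + (\<lambda>j. m n * unit_vec n j)"
      by (auto simp: fun_eq_iff unit_vec_def less_Suc_eq)
    then show ?case using Suc by (simp add: weight_vec_add weight_vec_cmult)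
  qed
  moreover have "(\<lambda>j. if j < r then m j else 0) = m" using assms by (auto simp: exponents_def fun_eq_iff)
  ultimately show ?thesis by metis
qed

lemma V_eq: "V = span (weight_vec ` exponents r)"
proof -
  have "\<iota> ` characters T = weight_vec ` exponents r" unfolding characters_eq weight_vec_def image_image ..
  then show ?thesis using ext unfolding real_extension_def by simp
qed

lemma weight_vec_in_V: "m \<in> exponents r \<Longrightarrow> weight_vec m \<in> V"
  unfolding V_eq by (intro span_base imageI)

lemma subspace_V: "subspace V"
  unfolding V_eq by simp

text \<open>
  Reading off the \<open>i\<close>-th exponent of a character is additive and so extends to a linear function.  This
  shows that the vectors of the coordinate characters are linearly independent.
\<close>

lemma coordinate_exists: "\<exists>h :: 'v \<Rightarrow> real. linear h \<and> (\<forall>m\<in>exponents r. h (weight_vec m) = of_int (m i))"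
proof -
  define f where "f \<eta> = real_of_int (inv_into (exponents r) char_of \<eta> i)" for \<eta>
  have inj: "inj_on char_of (exponents r)" using char_of_inj by (intro inj_onI)
  have f: "f (char_of m) = of_int (m i)" if "m \<in> exponents r" for m
    unfolding f_def using inj that by (simp add: inv_into_f_f)
  have "f (char_mult T \<eta> \<psi>) = f \<eta> + f \<psi>" if ch: "\<eta> \<in> characters T" "\<psi> \<in> characters T" for \<eta> \<psi>
  proof -
    obtain m n where "m \<in> exponents r" "n \<in> exponents r" "\<eta> = char_of m" "\<psi> = char_of n"
      using ch unfolding characters_eq by blast
    then show ?thesis by (simp add: char_mult_char_of f exponents_add)
  qed
  then obtain h :: "'v \<Rightarrow> real" where "linear h" "\<forall>\<eta>\<in>characters T. h (\<iota> \<eta>) = f \<eta>"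
    using additive_extension[of f] by blast
  then show ?thesis using f char_of_in_characters unfolding weight_vec_def by auto
qed

definition coordinate :: "nat \<Rightarrow> 'v \<Rightarrow> real" where
  "coordinate i = (SOME h. linear h \<and> (\<forall>m\<in>exponents r. h (weight_vec m) = of_int (m i)))"

lemma linear_coordinate: "linear (coordinate i)"
  and coordinate_weight_vec: "m \<in> exponents r \<Longrightarrow> coordinate i (weight_vec m) = of_int (m i)"
  using someI_ex[OF coordinate_exists[of i]] unfolding coordinate_def by auto

lemma coordinate_expansion:
  assumes "v \<in> V" shows "v = (\<Sum>i<r. coordinate i v *\<^sub>R weight_vec (unit_vec i))"
proof -
  let ?g = "\<lambda>v. \<Sum>i<r. coordinate i v *\<^sub>R weight_vec (unit_vec i)"
  have lin: "linear ?g"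
    by (auto intro!: linearI simp: linear_add[OF linear_coordinate] linear_scale[OF linear_coordinate]
        scaleR_left_distrib sum.distrib scaleR_sum_right)
  have eq: "id x = ?g x" if x: "x \<in> weight_vec ` exponents r" for x
  proof -
    obtain m where m: "m \<in> exponents r" "x = weight_vec m" using x by blast
    show ?thesis unfolding m(2) id_apply coordinate_weight_vec[OF m(1)] by (rule weight_vec_eq_sum[OF m(1)])
  qed
  have mem: "v \<in> span (weight_vec ` exponents r)" using assms by (simp add: V_eq)
  have "id v = ?g v" by (rule linear_eq_on_span[of id ?g, OF linear_id lin eq mem])
  then show ?thesis by simp
qed

lemma weight_vec_inj: 
  assumes "m \<in> exponents r" "n \<in> exponents r" "weight_vec m = weight_vec n" shows "m = n"
proof (rule exponents_ext[OF assms(1,2)])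
  show "m i = n i" for i using coordinate_weight_vec[of m i] coordinate_weight_vec[of n i] assms by simp
qed

lemma linear_on_V:
  fixes f :: "'v \<Rightarrow> real"
  assumes "linear f" "\<And>m. m \<in> exponents r \<Longrightarrow> f (weight_vec m) = (\<Sum>i<r. c i * of_int (m i))" "v \<in> V"
  shows "f v = (\<Sum>i<r. c i * coordinate i v)"
proof (rule linear_eq_on_span[of f _ "weight_vec ` exponents r" v])
  show "linear (\<lambda>v. \<Sum>i<r. c i * coordinate i v)"
    by (auto intro!: linearI simp: linear_add[OF linear_coordinate] linear_scale[OF linear_coordinate]
        distrib_left sum.distrib sum_distrib_left mult_ac)
qed (use assms in \<open>auto simp: V_eq coordinate_weight_vec\<close>)

lemma real_pairing_linear:
  assumes "\<gamma> \<in> cocharacters T"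
  shows "linear (real_pairing T \<iota> \<gamma>)"
    and "\<eta> \<in> characters T \<Longrightarrow> real_pairing T \<iota> \<gamma> (\<iota> \<eta>) = of_int (pairing \<gamma> \<eta>)"
proof -
  have "\<exists>h :: 'v \<Rightarrow> real. linear h \<and> (\<forall>\<eta>\<in>characters T. h (\<iota> \<eta>) = of_int (pairing \<gamma> \<eta>))"
    by (rule additive_extension) (simp add: pairing_char_mult[OF assms])
  from someI_ex[OF this] show "linear (real_pairing T \<iota> \<gamma>)"
    "\<eta> \<in> characters T \<Longrightarrow> real_pairing T \<iota> \<gamma> (\<iota> \<eta>) = of_int (pairing \<gamma> \<eta>)"
    unfolding real_pairing_def by auto
qed

lemma real_pairing_cochar:
  assumes "v \<in> V"
  shows "real_pairing T \<iota> (cochar n) v = (\<Sum>i<r. of_int (n i) * coordinate i v)"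
proof (rule linear_on_V[OF real_pairing_linear(1)[OF cochar_in_cocharacters] _ assms])
  show "real_pairing T \<iota> (cochar n) (weight_vec m) = (\<Sum>i<r. of_int (n i) * of_int (m i))" for m
    unfolding weight_vec_def real_pairing_linear(2)[OF cochar_in_cocharacters char_of_in_characters] pairing_cochar
    by simp
qed

lemma pairing_le_zero_on_cone:
  assumes "\<gamma> \<in> cocharacters T" "\<And>m. m \<in> A \<Longrightarrow> pairing \<gamma> (char_of m) \<le> 0"
    "l \<in> convex_cone hull (weight_vec ` A)"
  shows "real_pairing T \<iota> \<gamma> l \<le> 0"
proof -
  let ?h = "real_pairing T \<iota> \<gamma>"
  note lin = real_pairing_linear(1)[OF assms(1)]
  have "convex_cone {l. ?h l \<le> 0}"
    by (auto simp: convex_cone_iff linear_0[OF lin] linear_add[OF lin] linear_scale[OF lin] mult_nonneg_nonpos)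
  moreover have "weight_vec ` A \<subseteq> {l. ?h l \<le> 0}"
    using assms(2) real_pairing_linear(2)[OF assms(1) char_of_in_characters] unfolding weight_vec_def by auto
  ultimately have "convex_cone hull (weight_vec ` A) \<subseteq> {l. ?h l \<le> 0}" by (intro hull_minimal)
  then show ?thesis using assms(3) by blast
qed

text \<open>
  Farkas' lemma over the integers.  The finitely generated cone is closed, hence separated from \<open>l\<close> by a
  real functional, which can be made integral.
\<close>

lemma separating_cocharacter:
  assumes "finite A" "A \<subseteq> exponents r" "l \<in> V" "l \<notin> convex_cone hull (weight_vec ` A)"
  obtains n where "\<And>m. m \<in> A \<Longrightarrow> pairing (cochar n) (char_of m) \<le> 0"
    "real_pairing T \<iota> (cochar n) l > 0"
proof -
  let ?K = "convex_cone hull (weight_vec ` A)"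
  have "closed ?K" using assms(1) by (intro polyhedron_imp_closed polyhedron_convex_cone_hull) simp
  then obtain a b where ab: "a \<bullet> l < b" "\<And>x. x \<in> ?K \<Longrightarrow> a \<bullet> x > b"
    using separating_hyperplane_closed_point[OF convex_convex_cone_hull _ assms(4)] by blast
  have b: "b < 0" using ab(2)[OF convex_cone_hull_contains_0] by simp
  have K: "a \<bullet> x \<ge> 0" if "x \<in> ?K" for x
  proof (rule ccontr)
    assume neg: "\<not> a \<bullet> x \<ge> 0"
    \<comment> \<open>rescaling \<open>x\<close> within the cone would reach the separating level \<open>b\<close>\<close>
    have "(b / (a \<bullet> x)) *\<^sub>R x \<in> ?K" using that b neg by (intro convex_cone_hull_mul) (simp_all add: divide_nonpos_neg)
    from ab(2)[OF this] show False using neg by simp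
  qed
  define c where "c i = - (a \<bullet> weight_vec (unit_vec i))" for i
  have c: "(\<Sum>i<r. c i * coordinate i v) = - (a \<bullet> v)" if "v \<in> V" for v
    using arg_cong[OF coordinate_expansion[OF that], of "\<lambda>v. a \<bullet> v"]
    by (simp add: c_def inner_sum_right sum_negf mult.commute)
  obtain n where n: "\<And>m. m \<in> A \<Longrightarrow> (\<Sum>j<r. n j * m j) \<le> 0"
    "(\<Sum>j<r. of_int (n j) * coordinate j l) > 0"
  proof (rule integral_separation[of "{..<r}" A c "\<lambda>i. coordinate i l"])
    show "(\<Sum>j<r. c j * of_int (m j)) \<le> 0" if "m \<in> A" for m
    proof -
      have m: "m \<in> exponents r" using that assms(2) by blast
      have "(\<Sum>j<r. c j * of_int (m j)) = - (a \<bullet> weight_vec m)"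
        using c[OF weight_vec_in_V[OF m]] by (simp add: coordinate_weight_vec[OF m])
      then show ?thesis using K[OF hull_inc[of "weight_vec m" "weight_vec ` A"]] that by simp
    qed
    show "(\<Sum>j<r. c j * coordinate j l) > 0" using c[OF assms(3)] ab(1) b by simp
  qed (use assms in auto)
  then show ?thesis using that[of n] real_pairing_cochar[OF assms(3), of n] pairing_cochar by simp
qed

text \<open>
  A nonzero vector of \<open>V\<close> orthogonal to the characters in \<open>A\<close> gives a real functional that vanishes on
  them, but not on \<open>V\<close>.  It can be made integral without losing a chosen nonzero coefficient.
\<close>

lemma orthogonal_cocharacter:
  assumes "finite A" "A \<subseteq> exponents r" "span (weight_vec ` A) \<noteq> V"
  obtains n i where "\<And>m. m \<in> A \<Longrightarrow> pairing (cochar n) (char_of m) = 0" "i < r" "n i \<noteq> 0"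
proof -
  have "span (weight_vec ` A) \<subset> span V"
    using assms(2,3) weight_vec_in_V subspace_V span_minimal[of "weight_vec ` A" V] by (simp add: span_eq_iff[THEN iffD2] psubset_eq image_subset_iff subset_eq)
  then obtain u where u: "u \<noteq> 0" "u \<in> span V" "\<And>y. y \<in> span (weight_vec ` A) \<Longrightarrow> orthogonal u y"
    using orthogonal_to_subspace_exists_gen by blast
  have uV: "u \<in> V" using u(2) subspace_V by (simp add: span_eq_iff[THEN iffD2])
  define c where "c i = u \<bullet> weight_vec (unit_vec i)" for i
  have c: "(\<Sum>i<r. c i * coordinate i v) = u \<bullet> v" if "v \<in> V" for v
    using arg_cong[OF coordinate_expansion[OF that], of "\<lambda>v. u \<bullet> v"]
    by (simp add: c_def inner_sum_right mult.commute)
  obtain i where i: "i < r" "c i \<noteq> 0"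
  proof -
    have "(\<Sum>i<r. c i * coordinate i u) \<noteq> 0" using c[OF uV] u(1) by simp
    then obtain i where "i \<in> {..<r}" "c i * coordinate i u \<noteq> 0" by (rule sum.not_neutral_contains_not_neutral)
    then show ?thesis using that by auto
  qed
  obtain n where "\<And>m. m \<in> A \<Longrightarrow> (\<Sum>j<r. n j * m j) = 0" "n i \<noteq> 0"
  proof (rule integral_orthogonal[of "{..<r}" A c i])
    show "(\<Sum>j<r. c j * of_int (m j)) = 0" if "m \<in> A" for m
    proof -
      have m: "m \<in> exponents r" using that assms(2) by blast
      have "(\<Sum>j<r. c j * of_int (m j)) = u \<bullet> weight_vec m"
        using c[OF weight_vec_in_V[OF m]] by (simp add: coordinate_weight_vec[OF m])
      then show ?thesis using u(3)[OF span_base[of "weight_vec m" "weight_vec ` A"]] that by (simp add: orthogonal_def)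
    qed
  qed (use assms i in auto)
  then show ?thesis using that i(1) pairing_cochar by metis
qed

text \<open>
  If the characters in \<open>A\<close> span over the reals, then they generate a subgroup of finite index: it
  contains a positive multiple of each coordinate character.
\<close>

lemma finite_index_sublattice:
  assumes "finite A" "A \<subseteq> exponents r" "span (weight_vec ` A) = V" "i < r"
  obtains N p where "N > 0" "\<And>j. j < r \<Longrightarrow> N * unit_vec i j = (\<Sum>m\<in>A. p m * m j)"
proof -
  have "weight_vec (unit_vec i) \<in> span (weight_vec ` A)" using assms weight_vec_in_V unit_vec_in_exponents by blast
  then obtain c where c: "weight_vec (unit_vec i) = (\<Sum>v\<in>weight_vec ` A. c v *\<^sub>R v)"
    using span_finite[of "weight_vec ` A"] assms(1) by auto
  have "inj_on weight_vec A" using assms(2) weight_vec_inj by (intro inj_onI) blast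
  then have c': "weight_vec (unit_vec i) = (\<Sum>m\<in>A. c (weight_vec m) *\<^sub>R weight_vec m)"
    unfolding c by (simp add: sum.reindex)
  obtain N p where "N > 0" "\<And>j. j \<in> {..<r} \<Longrightarrow> N * unit_vec i j = (\<Sum>m\<in>A. p m * m j)"
  proof (rule integral_combination[of A "{..<r}" "unit_vec i" "\<lambda>m. c (weight_vec m)" "\<lambda>m. m"])
    fix j assume "j \<in> {..<r}"
    have "of_int (unit_vec i j) = coordinate j (weight_vec (unit_vec i))"
      using unit_vec_in_exponents[OF assms(4)] by (simp add: coordinate_weight_vec)
    also have "\<dots> = (\<Sum>m\<in>A. c (weight_vec m) * coordinate j (weight_vec m))"
      unfolding c' by (simp add: linear_sum[OF linear_coordinate] linear_scale[OF linear_coordinate])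
    also have "\<dots> = (\<Sum>m\<in>A. c (weight_vec m) * of_int (m j))"
      using assms(2) by (intro sum.cong) (auto simp: coordinate_weight_vec)
    finally show "of_int (unit_vec i j) = (\<Sum>m\<in>A. c (weight_vec m) * of_int (m j))" .
  qed (use assms in auto)
  then show ?thesis using that by auto
qed

end

section \<open>Weights of a torus representation\<close>

lemma laurent_expansion_linear_combination:
  assumes "finite A" "\<And>a. a \<in> A \<Longrightarrow> laurent_expansion r (f a) (c a)"
  shows "laurent_expansion r (\<lambda>t. \<Sum>a\<in>A. k a * f a t) (\<lambda>m. \<Sum>a\<in>A. k a * c a m)"
  using assms
proof (induction A rule: finite_induct)
  case empty
  then show ?case using laurent_expansion_zero by simp
next
  case (insert a A)
  then have "laurent_expansion r (\<lambda>t. k a * f a t + (\<Sum>a\<in>A. k a * f a t))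
      (\<lambda>m. k a * c a m + (\<Sum>a\<in>A. k a * c a m))"
    by (intro laurent_expansion_add laurent_expansion_cmult) auto
  then show ?case using insert.hyps by simp
qed

lemma (in vector_space) functional_iff:
  "functional scale \<phi> \<longleftrightarrow> (\<forall>x y. \<phi> (x + y) = \<phi> x + \<phi> y) \<and> (\<forall>c x. \<phi> (scale c x) = c * \<phi> x)"
proof -
  have "vector_space ((*) :: 'a \<Rightarrow> 'a \<Rightarrow> 'a)" by unfold_locales (auto simp: algebra_simps)
  then show ?thesis using vector_space_axioms unfolding Vector_Spaces.linear_iff by simp
qed

locale torus_representation = split_torus_chart T r \<theta> + finite_dimensional_vector_space sc B
  for T :: "('k::field_char_0^'m^'m) set" and r \<theta>
    and sc :: "'k \<Rightarrow> 'x::ab_group_add \<Rightarrow> 'x" and B +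
  fixes \<rho> :: "'k^'m^'m \<Rightarrow> 'x \<Rightarrow> 'x"
  assumes rep: "linear_rep sc T \<rho>"
begin

abbreviation dual :: "('x \<Rightarrow> 'k) \<Rightarrow> bool" where "dual \<equiv> functional sc"

text \<open>
  The action through inverses.  A linear form of weight \<open>m\<close> for the contragredient action is multiplied
  by \<open>char_of m g\<close> when composed with it, so that no signs enter the exponents.
\<close>

definition contra :: "'k^'m^'m \<Rightarrow> 'x \<Rightarrow> 'x" where "contra g = \<rho> (matrix_inv g)"

lemma dual_add: "dual \<phi> \<Longrightarrow> \<phi> (x + y) = \<phi> x + \<phi> y"
  and dual_scale_arg: "dual \<phi> \<Longrightarrow> \<phi> (sc c x) = c * \<phi> x"
  unfolding functional_iff by auto

lemma dual_zero: "dual \<phi> \<Longrightarrow> \<phi> 0 = 0"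
  using dual_add[of \<phi> 0 0] by simp

lemma dual_sum: "dual \<phi> \<Longrightarrow> \<phi> (sum f A) = (\<Sum>a\<in>A. \<phi> (f a))"
  by (induction A rule: infinite_finite_induct) (auto simp: dual_zero dual_add)

lemma rho_linear: 
  assumes "g \<in> T"
  shows rho_add: "\<rho> g (x + y) = \<rho> g x + \<rho> g y" and rho_scale: "\<rho> g (sc c x) = sc c (\<rho> g x)"
  using rep assms unfolding linear_rep_def Vector_Spaces.linear_iff by auto

lemma dual_contra: "dual \<phi> \<Longrightarrow> g \<in> T \<Longrightarrow> dual (\<lambda>x. \<phi> (contra g x))"
  unfolding functional_iff contra_def by (simp add: rho_add rho_scale inv_in_T)

lemma contra_mult:
  assumes "g \<in> T" "h \<in> T" shows "contra g (contra h x) = contra (g ** h) x"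
proof -
  have "\<rho> (matrix_inv g ** matrix_inv h) = \<rho> (matrix_inv g) \<circ> \<rho> (matrix_inv h)"
    using rep assms inv_in_T unfolding linear_rep_def by blast
  then show ?thesis unfolding contra_def inv_mult[OF assms] by simp
qed

lemma contra_one: "contra (mat 1) x = x"
proof -
  have "matrix_inv (mat 1 :: 'k^'m^'m) = mat 1"
    using T_GL one_in_T by (intro matrix_inv_unique) auto
  then show ?thesis using rep unfolding contra_def linear_rep_def by simp
qed

lemma contra_inv: "g \<in> T \<Longrightarrow> contra (matrix_inv g) x = \<rho> g x"
  unfolding contra_def by (simp add: inv_inv)

lemma matrix_coefficient_laurent: "dual \<phi> \<Longrightarrow> is_laurent r (\<lambda>t. \<phi> (contra (\<theta> t) x))"
  using rep regular_on_laurent[OF regular_on_inv, of "\<lambda>g. \<phi> (\<rho> g x)"]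
  unfolding linear_rep_def contra_def by simp

text \<open>
  The coefficients of the matrix coefficient \<open>\<lambda>g. \<phi> (contra g x)\<close>, expanded into characters.
\<close>

definition coeff_at :: "('x \<Rightarrow> 'k) \<Rightarrow> 'x \<Rightarrow> (nat \<Rightarrow> int) \<Rightarrow> 'k" where
  "coeff_at \<phi> x = (SOME c. laurent_expansion r (\<lambda>t. \<phi> (contra (\<theta> t) x)) c)"

lemma coeff_at_expansion:
  assumes "dual \<phi>" shows "laurent_expansion r (\<lambda>t. \<phi> (contra (\<theta> t) x)) (coeff_at \<phi> x)"
  using matrix_coefficient_laurent[OF assms, of x] unfolding coeff_at_def is_laurent_def by (rule someI_ex)

lemma coeff_at_eqI:
  assumes "dual \<phi>" "laurent_expansion r (\<lambda>t. \<phi> (contra (\<theta> t) x)) c"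
  shows "coeff_at \<phi> x = c"
  using laurent_expansion_unique[OF coeff_at_expansion[OF assms(1)] assms(2)] .

lemma finite_coeff_at: "dual \<phi> \<Longrightarrow> finite {m. coeff_at \<phi> x m \<noteq> 0}"
  and coeff_at_in_exponents: "dual \<phi> \<Longrightarrow> coeff_at \<phi> x m \<noteq> 0 \<Longrightarrow> m \<in> exponents r"
  using coeff_at_expansion[of \<phi> x] unfolding laurent_expansion_def by auto

lemma contra_eq_coeff_sum:
  assumes "dual \<phi>" "g \<in> T" "finite A" "{m. coeff_at \<phi> x m \<noteq> 0} \<subseteq> A"
  shows "\<phi> (contra g x) = (\<Sum>m\<in>A. coeff_at \<phi> x m * char_of m g)"
  using laurent_expansion_sum[OF coeff_at_expansion[OF assms(1)] coord_in[OF assms(2)] assms(3,4)] assms(2)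
  by (simp add: theta_coord char_of_def)

lemma coeff_at_add: 
  assumes "dual \<phi>" shows "coeff_at \<phi> (x + y) m = coeff_at \<phi> x m + coeff_at \<phi> y m"
proof -
  have "laurent_expansion r (\<lambda>t. \<phi> (contra (\<theta> t) (x + y))) (\<lambda>m. coeff_at \<phi> x m + coeff_at \<phi> y m)"
    by (rule laurent_expansion_cong[OF laurent_expansion_add[OF coeff_at_expansion coeff_at_expansion]])
       (simp_all add: assms dual_add contra_def rho_add inv_in_T theta_in_T)
  from coeff_at_eqI[OF assms this] show ?thesis by simp
qed

lemma coeff_at_scale: 
  assumes "dual \<phi>" shows "coeff_at \<phi> (sc c x) m = c * coeff_at \<phi> x m"
proof -
  have "laurent_expansion r (\<lambda>t. \<phi> (contra (\<theta> t) (sc c x))) (\<lambda>m. c * coeff_at \<phi> x m)"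
    by (rule laurent_expansion_cong[OF laurent_expansion_cmult[OF coeff_at_expansion]])
       (simp_all add: assms dual_scale_arg contra_def rho_scale inv_in_T theta_in_T)
  from coeff_at_eqI[OF assms this] show ?thesis by simp
qed

lemma dual_coeff_at: "dual \<phi> \<Longrightarrow> dual (\<lambda>x. coeff_at \<phi> x m)"
  unfolding functional_iff[of "\<lambda>x. coeff_at \<phi> x m"] by (simp add: coeff_at_add coeff_at_scale)

text \<open>
  Translating a matrix coefficient by \<open>g\<close> multiplies the coefficient of each character by its value at
  \<open>g\<close>.  As the torus is commutative, it does not matter whether \<open>x\<close> or \<open>\<phi>\<close> is translated.
\<close>

lemma coeff_at_contra:
  assumes "dual \<phi>" "g \<in> T"
  shows "coeff_at \<phi> (contra g x) m = char_of m g * coeff_at \<phi> x m"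
    and "coeff_at (\<lambda>x. \<phi> (contra g x)) x m = char_of m g * coeff_at \<phi> x m"
proof -
  have eq: "\<phi> (contra (g ** \<theta> t) x) = (\<Sum>m | coeff_at \<phi> x m \<noteq> 0. (char_of m g * coeff_at \<phi> x m) * monomial r m t)"
    if "t \<in> Gm_power r" for t
    using contra_eq_coeff_sum[OF assms(1) mult_in_T[OF assms(2) theta_in_T[OF that]] finite_coeff_at[OF assms(1)] order_refl] that
    by (simp add: char_of_mult assms(2) theta_in_T char_of_theta mult_ac)
  have exp: "laurent_expansion r (\<lambda>t. \<phi> (contra (g ** \<theta> t) x)) (\<lambda>m. char_of m g * coeff_at \<phi> x m)"
    by (rule laurent_expansionI[OF finite_coeff_at[OF assms(1)]]) (auto simp: eq coeff_at_in_exponents[OF assms(1)])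
  have "laurent_expansion r (\<lambda>t. \<phi> (contra (\<theta> t) (contra g x))) (\<lambda>m. char_of m g * coeff_at \<phi> x m)"
    by (rule laurent_expansion_cong[OF exp])
       (simp add: contra_mult assms(2) theta_in_T T_commute)
  from coeff_at_eqI[OF assms(1) this] show "coeff_at \<phi> (contra g x) m = char_of m g * coeff_at \<phi> x m" by simp
  have "laurent_expansion r (\<lambda>t. \<phi> (contra g (contra (\<theta> t) x))) (\<lambda>m. char_of m g * coeff_at \<phi> x m)"
    by (rule laurent_expansion_cong[OF exp]) (simp add: contra_mult assms(2) theta_in_T)
  from coeff_at_eqI[OF dual_contra[OF assms] this]
  show "coeff_at (\<lambda>x. \<phi> (contra g x)) x m = char_of m g * coeff_at \<phi> x m" by simp
qed

definition bcoord :: "'x \<Rightarrow> 'x \<Rightarrow> 'k" where "bcoord b x = representation B x b"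

lemma dual_bcoord: "dual (bcoord b)"
  unfolding functional_iff bcoord_def
  by (simp add: representation_add representation_scale independent_Basis span_Basis)

lemma bcoord_sum: "(\<Sum>b\<in>B. sc (bcoord b x) b) = x"
  unfolding bcoord_def by (intro sum_representation_eq) (auto simp: independent_Basis span_Basis finite_Basis)

lemma dual_eq_bcoord: 
  assumes "dual \<phi>" shows "\<phi> x = (\<Sum>b\<in>B. \<phi> b * bcoord b x)"
proof -
  have "\<phi> x = \<phi> (\<Sum>b\<in>B. sc (bcoord b x) b)" by (simp add: bcoord_sum)
  then show ?thesis by (simp add: dual_sum[OF assms] dual_scale_arg[OF assms] mult.commute)
qed

lemma dual_separates:
  assumes "\<And>\<phi>. dual \<phi> \<Longrightarrow> \<phi> x = \<phi> y" shows "x = y"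
proof -
  have eq: "bcoord b x = bcoord b y" for b by (rule assms[OF dual_bcoord[of b]])
  have "x = (\<Sum>b\<in>B. sc (bcoord b x) b)" by (simp only: bcoord_sum)
  also have "\<dots> = (\<Sum>b\<in>B. sc (bcoord b y) b)" by (simp only: eq)
  also have "\<dots> = y" by (simp only: bcoord_sum)
  finally show ?thesis .
qed

text \<open>
  The projection of \<open>x\<close> to a weight space, assembled from its coordinates with respect to the basis.
\<close>

definition component :: "(nat \<Rightarrow> int) \<Rightarrow> 'x \<Rightarrow> 'x" where
  "component m x = (\<Sum>b\<in>B. sc (coeff_at (bcoord b) x m) b)"

lemma dual_apply_component:
  assumes "dual \<phi>" shows "\<phi> (component m x) = coeff_at \<phi> x m"
proof -
  have "laurent_expansion r (\<lambda>t. \<Sum>b\<in>B. \<phi> b * bcoord b (contra (\<theta> t) x)) (\<lambda>m. \<Sum>b\<in>B. \<phi> b * coeff_at (bcoord b) x m)"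
    by (intro laurent_expansion_linear_combination finite_Basis coeff_at_expansion dual_bcoord)
  then have "laurent_expansion r (\<lambda>t. \<phi> (contra (\<theta> t) x)) (\<lambda>m. \<Sum>b\<in>B. \<phi> b * coeff_at (bcoord b) x m)"
    by (simp only: dual_eq_bcoord[OF assms, symmetric])
  from coeff_at_eqI[OF assms this] show ?thesis
    unfolding component_def by (simp add: dual_sum[OF assms] dual_scale_arg[OF assms] mult.commute)
qed

lemma contra_component:
  assumes "g \<in> T" shows "contra g (component m x) = sc (char_of m g) (component m x)"
proof (rule dual_separates)
  fix \<phi> assume \<phi>: "dual \<phi>"
  have "\<phi> (contra g (component m x)) = coeff_at (\<lambda>x. \<phi> (contra g x)) x m"
    using dual_apply_component[OF dual_contra[OF \<phi> assms]] .
  then show "\<phi> (contra g (component m x)) = \<phi> (sc (char_of m g) (component m x))"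
    by (simp add: coeff_at_contra(2)[OF \<phi> assms] dual_scale_arg[OF \<phi>] dual_apply_component[OF \<phi>])
qed

text \<open>
  The weights of the dual representation that do not vanish at \<open>x\<close>, see \<open>supp_iff_dual_weights\<close>.
\<close>

definition supp :: "'x \<Rightarrow> (nat \<Rightarrow> int) set" where
  "supp x = {m. component m x \<noteq> 0}"

lemma supp_iff: "m \<in> supp x \<longleftrightarrow> (\<exists>\<phi>. dual \<phi> \<and> coeff_at \<phi> x m \<noteq> 0)"
proof
  assume "m \<in> supp x"
  then have "component m x \<noteq> 0" unfolding supp_def by simp
  then obtain \<phi> where "dual \<phi>" "\<phi> (component m x) \<noteq> \<phi> 0" using dual_separates[of "component m x" 0] by blast
  then show "\<exists>\<phi>. dual \<phi> \<and> coeff_at \<phi> x m \<noteq> 0" by (auto simp: dual_apply_component dual_zero)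
next
  assume "\<exists>\<phi>. dual \<phi> \<and> coeff_at \<phi> x m \<noteq> 0"
  then show "m \<in> supp x" unfolding supp_def by (auto simp: dual_apply_component[symmetric] dual_zero)
qed

lemma supp_exponents: "supp x \<subseteq> exponents r"
proof
  fix m assume "m \<in> supp x"
  then obtain \<phi> where "dual \<phi>" "coeff_at \<phi> x m \<noteq> 0" unfolding supp_iff by (elim exE conjE)
  then show "m \<in> exponents r" by (rule coeff_at_in_exponents)
qed

lemma supp_subset: "supp x \<subseteq> (\<Union>b\<in>B. {m. coeff_at (bcoord b) x m \<noteq> 0})"
proof
  fix m assume "m \<in> supp x"
  then show "m \<in> (\<Union>b\<in>B. {m. coeff_at (bcoord b) x m \<noteq> 0})"
    unfolding supp_def component_def by (auto intro!: sum.neutral)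
qed

lemma finite_supp: "finite (supp x)"
  by (rule finite_subset[OF supp_subset]) (auto intro!: finite_Basis finite_coeff_at dual_bcoord)

lemma contra_eq_supp_sum:
  assumes "dual \<phi>" "g \<in> T"
  shows "\<phi> (contra g x) = (\<Sum>m\<in>supp x. coeff_at \<phi> x m * char_of m g)"
  using assms by (intro contra_eq_coeff_sum finite_supp) (auto simp: supp_iff)

abbreviation dual_weights :: "(nat \<Rightarrow> int) \<Rightarrow> ('x \<Rightarrow> 'k) set" where
  "dual_weights m \<equiv> dual_weight_space sc T \<rho> (char_of m)"

lemma dual_weights_iff:
  "\<phi> \<in> dual_weights m \<longleftrightarrow> dual \<phi> \<and> (\<forall>t\<in>T. \<forall>x. \<phi> (contra t x) = char_of m t * \<phi> x)"
  unfolding dual_weight_space_def contra_def by simp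

lemma dual_weightsD:
  "\<phi> \<in> dual_weights m \<Longrightarrow> dual \<phi>"
  "\<phi> \<in> dual_weights m \<Longrightarrow> t \<in> T \<Longrightarrow> \<phi> (contra t x) = char_of m t * \<phi> x"
  by (simp_all add: dual_weights_iff)

lemma coeff_at_in_dual_weights: "dual \<phi> \<Longrightarrow> (\<lambda>x. coeff_at \<phi> x m) \<in> dual_weights m"
  unfolding dual_weights_iff using dual_coeff_at coeff_at_contra(1) by auto

lemma coeff_at_dual_weights:
  assumes "\<phi> \<in> dual_weights m" "m \<in> exponents r"
  shows "coeff_at \<phi> x n = (if n = m then \<phi> x else 0)"
proof -
  have \<phi>: "dual \<phi>" "\<And>t. t \<in> T \<Longrightarrow> \<phi> (contra t x) = char_of m t * \<phi> x"
    using assms(1) unfolding dual_weights_iff by auto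
  have "laurent_expansion r (\<lambda>t. \<phi> (contra (\<theta> t) x)) (\<lambda>n. \<phi> x * (if n = m then 1 else 0))"
    by (rule laurent_expansion_cong[OF laurent_expansion_cmult[OF laurent_expansion_monomial[OF assms(2)]]])
       (simp add: \<phi>(2) theta_in_T char_of_theta)
  from coeff_at_eqI[OF \<phi>(1) this] show ?thesis by simp
qed

lemma supp_iff_dual_weights:
  assumes "m \<in> exponents r"
  shows "m \<in> supp x \<longleftrightarrow> (\<exists>\<phi>\<in>dual_weights m. \<phi> x \<noteq> 0)"
proof
  assume "m \<in> supp x"
  then show "\<exists>\<phi>\<in>dual_weights m. \<phi> x \<noteq> 0" using coeff_at_in_dual_weights unfolding supp_iff by auto
next
  assume "\<exists>\<phi>\<in>dual_weights m. \<phi> x \<noteq> 0"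
  then obtain \<phi> where \<phi>: "\<phi> \<in> dual_weights m" "\<phi> x \<noteq> 0" by blast
  then show "m \<in> supp x"
    unfolding supp_iff using coeff_at_dual_weights[OF \<phi>(1) assms, of x m]
    by (auto simp: dual_weights_iff intro!: exI[of _ \<phi>])
qed

definition weights :: "(nat \<Rightarrow> int) set" where "weights = (\<Union>x. supp x)"

lemma weights_exponents: "weights \<subseteq> exponents r"
  unfolding weights_def using supp_exponents by blast

lemma weights_iff: "m \<in> exponents r \<Longrightarrow> m \<in> weights \<longleftrightarrow> dual_weights m \<noteq> {\<lambda>_. 0}"
proof -
  assume m: "m \<in> exponents r"
  have z: "(\<lambda>_. 0) \<in> dual_weights m"
    unfolding dual_weights_iff functional_iff by simp
  have "m \<in> weights \<longleftrightarrow> (\<exists>\<phi>\<in>dual_weights m. \<exists>x. \<phi> x \<noteq> 0)"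
    unfolding weights_def using supp_iff_dual_weights[OF m] by auto
  also have "\<dots> \<longleftrightarrow> (\<exists>\<phi>\<in>dual_weights m. \<phi> \<noteq> (\<lambda>_. 0))" by (simp add: fun_eq_iff)
  also have "\<dots> \<longleftrightarrow> dual_weights m \<noteq> {\<lambda>_. 0}" using z by blast
  finally show ?thesis .
qed

lemma finite_weights: "finite weights"
proof (rule finite_subset)
  show "weights \<subseteq> (\<Union>b\<in>B. supp b)"
  proof
    fix m assume "m \<in> weights"
    then obtain x where "m \<in> supp x" unfolding weights_def by blast
    then obtain \<phi> where \<phi>: "dual \<phi>" "coeff_at \<phi> x m \<noteq> 0" unfolding supp_iff by (elim exE conjE)
    have "coeff_at \<phi> x m = (\<Sum>b\<in>B. coeff_at \<phi> b m * bcoord b x)"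
      by (rule dual_eq_bcoord[OF dual_coeff_at[OF \<phi>(1)]])
    then have "(\<Sum>b\<in>B. coeff_at \<phi> b m * bcoord b x) \<noteq> 0" using \<phi>(2) by simp
    then obtain b where "b \<in> B" "coeff_at \<phi> b m * bcoord b x \<noteq> 0"
      by (rule sum.not_neutral_contains_not_neutral)
    then show "m \<in> (\<Union>b\<in>B. supp b)" using \<phi>(1) by (auto simp: supp_iff)
  qed
qed (simp add: finite_Basis finite_supp)

lemma coeff_at_component:
  assumes "dual \<phi>" "m \<in> exponents r"
  shows "coeff_at \<phi> (component m y) n = (if n = m then coeff_at \<phi> y m else 0)"
proof -
  have "laurent_expansion r (\<lambda>t. \<phi> (contra (\<theta> t) (component m y))) (\<lambda>n. coeff_at \<phi> y m * (if n = m then 1 else 0))"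
    by (rule laurent_expansion_cong[OF laurent_expansion_cmult[OF laurent_expansion_monomial[OF assms(2)]]])
       (simp add: contra_component theta_in_T char_of_theta dual_scale_arg[OF assms(1)] dual_apply_component[OF assms(1)])
  from coeff_at_eqI[OF assms(1) this] show ?thesis by simp
qed

text \<open>
  Add one nonzero weight vector for each element of \<open>S\<close>.
\<close>

lemma exists_supp_eq:
  assumes "S \<subseteq> weights" shows "\<exists>x. supp x = S"
proof -
  have "\<forall>m\<in>S. \<exists>y. component m y \<noteq> 0" using assms unfolding weights_def supp_def by auto
  then obtain y where y: "\<And>m. m \<in> S \<Longrightarrow> component m (y m) \<noteq> 0" by metis
  have fin: "finite S" using assms finite_weights finite_subset by blast
  define x where "x = (\<Sum>m\<in>S. component m (y m))"
  have coeff_at: "coeff_at \<phi> x n = (if n \<in> S then coeff_at \<phi> (y n) n else 0)" if "dual \<phi>" for \<phi> n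
  proof -
    have "coeff_at \<phi> x n = (\<Sum>m\<in>S. coeff_at \<phi> (component m (y m)) n)"
      unfolding x_def by (rule dual_sum[OF dual_coeff_at[OF that]])
    also have "\<dots> = (\<Sum>m\<in>S. if n = m then coeff_at \<phi> (y m) m else 0)"
      using assms weights_exponents by (intro sum.cong refl coeff_at_component[OF that]) auto
    also have "\<dots> = (if n \<in> S then coeff_at \<phi> (y n) n else 0)" using fin by simp
    finally show ?thesis .
  qed
  have "n \<in> supp x \<longleftrightarrow> n \<in> S" for n
  proof
    assume "n \<in> supp x"
    then show "n \<in> S" unfolding supp_iff by (auto simp: coeff_at split: if_splits)
  next
    assume n: "n \<in> S"
    then have "n \<in> supp (y n)" using y unfolding supp_def by simp
    then show "n \<in> supp x" using n unfolding supp_iff by (auto simp: coeff_at)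
  qed
  then show ?thesis by blast
qed

text \<open>
  If \<open>n\<close> were negative, then \<open>p\<close> times a positive power of the variable would agree with the nonzero
  constant \<open>c\<close> at infinitely many points, and hence also at 0, where it vanishes.
\<close>

lemma pole_free_power:
  fixes c :: 'k
  assumes "\<And>s. s \<noteq> 0 \<Longrightarrow> c * s powi n = poly p s" "c \<noteq> 0"
  shows "n \<ge> 0"
proof (rule ccontr)
  assume "\<not> n \<ge> 0"
  define N where "N = nat (- n)"
  have N: "N > 0" "n = - int N" using \<open>\<not> n \<ge> 0\<close> by (auto simp: N_def)
  let ?q = "monom 1 N * p - [:c:]"
  have "poly ?q s = 0" if "s \<noteq> 0" for s
    using assms(1)[OF that] that by (simp add: poly_monom N(2) power_int_minus field_simps)
  then have "UNIV - {0} \<subseteq> {s. poly ?q s = 0}" by auto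
  moreover have "infinite (UNIV - {0 :: 'k})" using infinite_UNIV_char_0 by simp
  ultimately have "?q = 0" using poly_roots_finite finite_subset by blast
  then have "poly ?q 0 = 0" by simp
  then show False using N(1) assms(2) by (simp add: poly_monom zero_power)
qed

text \<open>
  A matrix coefficient along \<open>\<gamma>\<close> is a combination of the powers of \<open>s\<close> whose exponents are the negated
  pairings with the weights in \<open>supp x\<close>, and a linear form of weight \<open>m\<close> isolates one of these powers.
\<close>

lemma limit_exists_iff:
  assumes \<gamma>: "\<gamma> \<in> cocharacters T"
  shows "limit_exists sc \<rho> \<gamma> x \<longleftrightarrow> (\<forall>m\<in>supp x. pairing \<gamma> (char_of m) \<le> 0)"
proof -
  have T: "\<gamma> s \<in> T" if "s \<noteq> 0" for s using \<gamma> that unfolding cocharacters_def by simp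
  have w: "char_of m (matrix_inv (\<gamma> s)) = s powi (- pairing \<gamma> (char_of m))" if "s \<noteq> 0" for s m
    using char_of_inv[OF T[OF that]] character_cocharacter[OF \<gamma> T_GL char_of_in_characters] that
    by (simp add: power_int_minus)
  have eq: "\<phi> (\<rho> (\<gamma> s) x) = (\<Sum>m\<in>supp x. coeff_at \<phi> x m * s powi (- pairing \<gamma> (char_of m)))"
    if "dual \<phi>" "s \<noteq> 0" for \<phi> s x
    using contra_eq_supp_sum[OF that(1) inv_in_T[OF T[OF that(2)]], of x]
    by (simp add: contra_inv T that(2) w)
  show ?thesis
  proof
    assume lim: "limit_exists sc \<rho> \<gamma> x"
    show "\<forall>m\<in>supp x. pairing \<gamma> (char_of m) \<le> 0"
    proof
      fix m assume m: "m \<in> supp x"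
      have ml: "m \<in> exponents r" using m supp_exponents by blast
      obtain \<phi> where \<phi>: "\<phi> \<in> dual_weights m" "\<phi> x \<noteq> 0"
        using m supp_iff_dual_weights[OF ml] by blast
      have d: "dual \<phi>" using \<phi>(1) unfolding dual_weights_iff by simp
      obtain p where p: "\<And>s. s \<noteq> 0 \<Longrightarrow> \<phi> (\<rho> (\<gamma> s) x) = poly p s"
        using lim d unfolding limit_exists_def by blast
      have "\<phi> x * s powi (- pairing \<gamma> (char_of m)) = poly p s" if "s \<noteq> 0" for s
      proof -
        have "\<phi> (contra (matrix_inv (\<gamma> s)) x) = char_of m (matrix_inv (\<gamma> s)) * \<phi> x"
          by (rule dual_weightsD(2)[OF \<phi>(1) inv_in_T[OF T[OF that]]])
        then show ?thesis using p[OF that] by (simp add: contra_inv T that w)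
      qed
      from pole_free_power[OF this \<phi>(2)] show "pairing \<gamma> (char_of m) \<le> 0" by simp
    qed
  next
    assume le: "\<forall>m\<in>supp x. pairing \<gamma> (char_of m) \<le> 0"
    show "limit_exists sc \<rho> \<gamma> x"
      unfolding limit_exists_def
    proof (intro allI impI)
      fix \<phi> assume d: "dual \<phi>"
      define p where "p = (\<Sum>m\<in>supp x. monom (coeff_at \<phi> x m) (nat (- pairing \<gamma> (char_of m))))"
      have "\<phi> (\<rho> (\<gamma> s) x) = poly p s" if "s \<noteq> 0" for s
        unfolding eq[OF d that] p_def poly_sum poly_monom
        using le by (intro sum.cong) (auto simp: power_int_def)
      then show "\<exists>p. \<forall>s. s \<noteq> 0 \<longrightarrow> \<phi> (\<rho> (\<gamma> s) x) = poly p s" by blast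
    qed
  qed
qed

text \<open>
  A linear form of weight \<open>m\<close> that does not vanish at \<open>x\<close> forces \<open>char_of m t = 1\<close>.  In the other
  direction the expansion of every matrix coefficient takes the same value at \<open>t\<close> and at the identity.
\<close>

lemma stabilizer_eq: "stabilizer T \<rho> x = {t\<in>T. \<forall>m\<in>supp x. char_of m t = 1}"
proof (intro set_eqI iffI)
  fix t assume "t \<in> stabilizer T \<rho> x"
  then have t: "t \<in> T" "\<rho> t x = x" unfolding stabilizer_def by auto
  have "contra t x = contra t (contra (matrix_inv t) x)" using t by (simp add: contra_inv)
  also have "\<dots> = x"
    using t(1) T_GL matrix_inv_inverse(1)[of t] by (auto simp: contra_mult inv_in_T contra_one)
  finally have fixed: "contra t x = x" .
  have "char_of m t = 1" if m: "m \<in> supp x" for m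
  proof -
    have ml: "m \<in> exponents r" using m supp_exponents by blast
    obtain \<phi> where \<phi>: "\<phi> \<in> dual_weights m" "\<phi> x \<noteq> 0"
      using m supp_iff_dual_weights[OF ml] by blast
    have "char_of m t * \<phi> x = 1 * \<phi> x" using dual_weightsD(2)[OF \<phi>(1) t(1), of x] fixed by simp
    then show ?thesis by (rule mult_right_cancel[OF \<phi>(2), THEN iffD1])
  qed
  then show "t \<in> {t\<in>T. \<forall>m\<in>supp x. char_of m t = 1}" using t by simp
next
  fix t assume "t \<in> {t\<in>T. \<forall>m\<in>supp x. char_of m t = 1}"
  then have t: "t \<in> T" "\<And>m. m \<in> supp x \<Longrightarrow> char_of m t = 1" by auto
  have "\<rho> t x = x"
  proof (rule dual_separates)
    fix \<phi> assume d: "dual \<phi>"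
    have "\<phi> (\<rho> t x) = (\<Sum>m\<in>supp x. coeff_at \<phi> x m * char_of m (matrix_inv t))"
      using contra_eq_supp_sum[OF d inv_in_T[OF t(1)]] by (simp add: contra_inv t(1))
    also have "\<dots> = (\<Sum>m\<in>supp x. coeff_at \<phi> x m * char_of m (mat 1))"
      using t by (intro sum.cong) (auto simp: char_of_inv char_of_one)
    also have "\<dots> = \<phi> x"
      using contra_eq_supp_sum[OF d one_in_T] by (simp add: contra_one)
    finally show "\<phi> (\<rho> t x) = \<phi> x" .
  qed
  then show "t \<in> stabilizer T \<rho> x" unfolding stabilizer_def using t(1) by simp
qed

text \<open>
  The dual space is spanned by the finitely many coordinate forms.  So the dimension is the size of an
  actual finite basis, and not the value 0 that \<open>card\<close> takes on infinite sets.
\<close>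

lemma dual_weight_mult_pos_iff:
  "dual_weight_mult sc T \<rho> (char_of m) > 0 \<longleftrightarrow> dual_weights m \<noteq> {\<lambda>_. 0}"
proof -
  interpret D: vector_space "dual_scale :: 'k \<Rightarrow> ('x \<Rightarrow> 'k) \<Rightarrow> 'x \<Rightarrow> 'k" by (rule vector_space_dual_scale)
  have z: "(\<lambda>_. 0) \<in> dual_weights m"
    unfolding dual_weights_iff functional_iff by simp
  obtain C where C: "C \<subseteq> dual_weights m" "D.independent C" "dual_weights m \<subseteq> D.span C"
    "card C = D.dim (dual_weights m)"
    by (rule D.basis_exists)
  have "dual_weights m \<subseteq> D.span (bcoord ` B)"
  proof
    fix \<phi> assume "\<phi> \<in> dual_weights m"
    then have d: "dual \<phi>" unfolding dual_weights_iff by simp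
    have "\<phi> = (\<Sum>b\<in>B. dual_scale (\<phi> b) (bcoord b))"
    proof
      fix x
      have "(\<Sum>b\<in>A. dual_scale (\<phi> b) (bcoord b)) x = (\<Sum>b\<in>A. \<phi> b * bcoord b x)" for A
        by (induction A rule: infinite_finite_induct) (auto simp: dual_scale_def)
      then show "\<phi> x = (\<Sum>b\<in>B. dual_scale (\<phi> b) (bcoord b)) x"
        using dual_eq_bcoord[OF d, of x] by simp
    qed
    also have "\<dots> \<in> D.span (bcoord ` B)"
      by (intro D.span_sum D.span_scale D.span_base imageI)
    finally show "\<phi> \<in> D.span (bcoord ` B)" .
  qed
  then have fin: "finite C"
    using D.independent_span_bound[OF _ C(2), of "bcoord ` B"] C(1) finite_Basis by blast
  have mult: "dual_weight_mult sc T \<rho> (char_of m) = card C" using C(4) by (simp add: dual_weight_mult_def)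
  show ?thesis
  proof
    assume "dual_weight_mult sc T \<rho> (char_of m) > 0"
    then obtain \<phi> where "\<phi> \<in> C" using mult by (metis card.empty ex_in_conv less_irrefl)
    moreover have "(\<lambda>_. 0) \<notin> C" using D.dependent_zero[of C] C(2) by (auto simp: zero_fun_def)
    ultimately have "\<phi> \<noteq> (\<lambda>_. 0)" by (intro notI) simp
    then show "dual_weights m \<noteq> {\<lambda>_. 0}" using subsetD[OF C(1) \<open>\<phi> \<in> C\<close>] by auto
  next
    assume ne: "dual_weights m \<noteq> {\<lambda>_. 0}"
    have "C \<noteq> {}"
    proof
      assume "C = {}"
      then have "dual_weights m \<subseteq> {\<lambda>_. 0}" using C(3) by (simp add: zero_fun_def)
      then show False using ne z by blast
    qed
    then show "dual_weight_mult sc T \<rho> (char_of m) > 0" using mult fin by (simp add: card_gt_0_iff)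
  qed
qed

lemma weight_index_fst: "fst ` weight_index sc T \<rho> = char_of ` weights"
proof (intro set_eqI iffI)
  fix \<eta> assume "\<eta> \<in> fst ` weight_index sc T \<rho>"
  then have "\<eta> \<in> characters T" "dual_weight_mult sc T \<rho> \<eta> > 0" unfolding weight_index_def by auto
  then obtain m where "m \<in> exponents r" "\<eta> = char_of m" "dual_weights m \<noteq> {\<lambda>_. 0}"
    using dual_weight_mult_pos_iff unfolding characters_eq by blast
  then show "\<eta> \<in> char_of ` weights" using weights_iff by blast
next
  fix \<eta> assume "\<eta> \<in> char_of ` weights"
  then obtain m where m: "m \<in> weights" "\<eta> = char_of m" by blast
  then have "dual_weight_mult sc T \<rho> \<eta> > 0" 
    using weights_iff weights_exponents dual_weight_mult_pos_iff by blast
  then have "(\<eta>, 0) \<in> weight_index sc T \<rho>"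
    unfolding weight_index_def using m char_of_in_characters by auto
  then show "\<eta> \<in> fst ` weight_index sc T \<rho>" by force
qed

lemma finite_weight_index: "finite (weight_index sc T \<rho>)"
proof (rule finite_subset)
  show "weight_index sc T \<rho> \<subseteq> (SIGMA \<eta>:char_of ` weights. {..<dual_weight_mult sc T \<rho> \<eta>})"
    using weight_index_fst by (force simp: weight_index_def)
qed (use finite_weights in auto)

end

section \<open>Semistability and stability in terms of weights\<close>

lemma finite_powi_eq_one:
  fixes N :: int
  assumes "N > 0" shows "finite {z :: 'k::field. z powi N = 1}"
proof -
  let ?q = "monom 1 (nat N) - 1 :: 'k poly"
  have "poly ?q 0 = - 1" using assms by (simp add: poly_monom zero_power)
  then have "?q \<noteq> 0" by (metis poly_0 neg_equal_0_iff_equal zero_neq_one)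
  moreover have "{z. z powi N = 1} = {z. poly ?q z = 0}" using assms by (simp add: poly_monom power_int_def)
  ultimately show ?thesis using poly_roots_finite by metis
qed

lemma powi_sum: "z \<noteq> 0 \<Longrightarrow> z powi (\<Sum>a\<in>A. f a) = (\<Prod>a\<in>A. z powi f a)" for z :: "'k::field"
  by (induction A rule: infinite_finite_induct) (auto simp: power_int_add)

lemma prod_powi: "(\<Prod>a\<in>A. f a) powi n = (\<Prod>a\<in>A. f a powi n)" for f :: "'a \<Rightarrow> 'k::field"
  by (induction A rule: infinite_finite_induct) (auto simp: power_int_mult_distrib)

locale git_setting = L: weight_lattice T r \<theta> V \<iota> + R: torus_representation T r \<theta> sc B \<rho>
  for T :: "('k::field_char_0^'m^'m) set" and r \<theta> and V :: "'v::euclidean_space set" and \<iota>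
    and sc :: "'k \<Rightarrow> 'x::ab_group_add \<Rightarrow> 'x" and B \<rho>
begin

text \<open>
  The Hilbert-Mumford criterion for a torus: the cocharacters with a limit at \<open>x\<close> are the
  integral points of the polar of the cone of the weights of \<open>x\<close>, and they already cut out this cone.
\<close>

lemma semistable_iff:
  assumes "l \<in> V"
  shows "x \<in> semistable sc T \<rho> \<iota> l \<longleftrightarrow> l \<in> convex_cone hull (L.weight_vec ` R.supp x)"
proof
  assume ss: "x \<in> semistable sc T \<rho> \<iota> l"
  show "l \<in> convex_cone hull (L.weight_vec ` R.supp x)"
  proof (rule ccontr)
    assume "l \<notin> convex_cone hull (L.weight_vec ` R.supp x)"
    then obtain n where n: "\<And>m. m \<in> R.supp x \<Longrightarrow> pairing (L.cochar n) (L.char_of m) \<le> 0"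
      "real_pairing T \<iota> (L.cochar n) l > 0"
      using L.separating_cocharacter[OF R.finite_supp R.supp_exponents assms] by blast
    have "limit_exists sc \<rho> (L.cochar n) x"
      using n(1) R.limit_exists_iff[OF L.cochar_in_cocharacters] by blast
    then show False
      using ss n(2) L.cochar_in_cocharacters unfolding semistable_def by force
  qed
next
  assume "l \<in> convex_cone hull (L.weight_vec ` R.supp x)"
  then show "x \<in> semistable sc T \<rho> \<iota> l"
    using L.pairing_le_zero_on_cone R.limit_exists_iff unfolding semistable_def by blast
qed

text \<open>
  Otherwise a nontrivial cocharacter on which all weights of \<open>x\<close> are trivial maps into the stabilizer,
  and the powers of 2 have infinitely many images under it.
\<close>

lemma finite_stabilizer_imp_span:
  assumes fin: "finite (stabilizer T \<rho> x)"
  shows "span (L.weight_vec ` R.supp x) = V"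
proof (rule ccontr)
  assume "span (L.weight_vec ` R.supp x) \<noteq> V"
  then obtain n i where n: "\<And>m. m \<in> R.supp x \<Longrightarrow> pairing (L.cochar n) (L.char_of m) = 0"
    and i: "i < r" "n i \<noteq> 0"
    using L.orthogonal_cocharacter[OF R.finite_supp R.supp_exponents] by blast
  have stab: "L.cochar n s \<in> stabilizer T \<rho> x" if "s \<noteq> 0" for s
    using character_cocharacter[OF L.cochar_in_cocharacters L.T_GL L.char_of_in_characters] n that
    unfolding R.stabilizer_eq by (simp add: L.cochar_in_T)
  have "(\<Sum>j<r. n j * unit_vec i j) = n i"
    using i(1) by (simp add: unit_vec_def if_distrib sum.delta cong: if_cong)
  then have w: "L.char_of (unit_vec i) (L.cochar n s) = s powi n i" if "s \<noteq> 0" for s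
    using L.char_of_cochar[OF that, of "unit_vec i" n] by simp
  have "inj (\<lambda>k. L.cochar n (2 ^ k))"
  proof (rule injI)
    fix k k' assume "L.cochar n (2 ^ k) = L.cochar n (2 ^ k')"
    then have "(2 ^ k :: 'k) powi n i = (2 ^ k') powi n i" using w by (metis power_not_zero zero_neq_numeral)
    then have "(2 :: 'k) powi (int k * n i) = 2 powi (int k' * n i)"
      by (simp add: power_int_mult)
    then have "int k * n i = int k' * n i" by (rule powi_2_inj)
    then show "k = k'" using i(2) by simp
  qed
  moreover have "range (\<lambda>k. L.cochar n (2 ^ k)) \<subseteq> stabilizer T \<rho> x" using stab by auto
  ultimately show False
    using range_inj_infinite finite_subset[OF _ fin] by blast
qed

text \<open>
  A multiple of every coordinate character is an integral combination of weights of \<open>x\<close>.  So the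
  coordinates of an element of the stabilizer are roots of unity of bounded order.
\<close>

lemma span_imp_finite_stabilizer:
  assumes "span (L.weight_vec ` R.supp x) = V"
  shows "finite (stabilizer T \<rho> x)"
proof -
  have "\<exists>N p. N > 0 \<and> (\<forall>j<r. N * unit_vec i j = (\<Sum>m\<in>R.supp x. p m * m j))" if i: "i < r" for i
  proof -
    obtain N p where "N > 0" "\<And>j. j < r \<Longrightarrow> N * unit_vec i j = (\<Sum>m\<in>R.supp x. p m * m j)"
      using L.finite_index_sublattice[OF R.finite_supp R.supp_exponents assms i] by blast
    then show ?thesis by blast
  qed
  then have "\<forall>i. \<exists>N p. i < r \<longrightarrow> N > 0 \<and> (\<forall>j<r. N * unit_vec i j = (\<Sum>m\<in>R.supp x. p m * m j))"
    by blast
  then obtain N p where Np: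
    "\<forall>i. i < r \<longrightarrow> N i > 0 \<and> (\<forall>j<r. N i * unit_vec i j = (\<Sum>m\<in>R.supp x. p i m * m j))"
    unfolding choice_iff by (elim exE)
  then have N: "\<And>i. i < r \<Longrightarrow> N i > 0"
    "\<And>i j. i < r \<Longrightarrow> j < r \<Longrightarrow> N i * unit_vec i j = (\<Sum>m\<in>R.supp x. p i m * m j)"
    by blast+
  have root: "L.coord t i powi N i = 1" if t: "t \<in> stabilizer T \<rho> x" and i: "i < r" for t i
  proof -
    have tT: "t \<in> T" and w: "\<And>m. m \<in> R.supp x \<Longrightarrow> L.char_of m t = 1"
      using t unfolding R.stabilizer_eq by auto
    let ?c = "L.coord t"
    have nz: "?c j \<noteq> 0" if "j < r" for j using Gm_power_nonzero[OF L.coord_in[OF tT] that] .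
    have "?c i powi N i = (\<Prod>j<r. if j = i then ?c i powi N i else 1)" using i by simp
    also have "\<dots> = (\<Prod>j<r. ?c j powi (\<Sum>m\<in>R.supp x. p i m * m j))"
      by (intro prod.cong refl) (auto simp: N(2)[OF i, symmetric] unit_vec_def)
    also have "\<dots> = (\<Prod>j<r. \<Prod>m\<in>R.supp x. (?c j powi m j) powi p i m)"
      using nz by (intro prod.cong refl) (simp add: powi_sum power_int_mult[symmetric] mult.commute)
    also have "\<dots> = (\<Prod>m\<in>R.supp x. \<Prod>j<r. (?c j powi m j) powi p i m)" by (rule prod.swap)
    also have "\<dots> = (\<Prod>m\<in>R.supp x. monomial r m ?c powi p i m)"
      unfolding monomial_def prod_powi ..
    also have "\<dots> = 1" using w tT by (intro prod.neutral) (simp add: L.char_of_def)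
    finally show ?thesis .
  qed
  have "L.coord ` stabilizer T \<rho> x \<subseteq> PiE {..<r} (\<lambda>i. {z. z powi N i = 1})"
  proof clarify
    fix t assume t: "t \<in> stabilizer T \<rho> x"
    then have "L.coord t \<in> Gm_power r" by (intro L.coord_in) (simp add: stabilizer_def)
    then show "L.coord t \<in> PiE {..<r} (\<lambda>i. {z. z powi N i = 1})"
      using root[OF t] unfolding Gm_power_def by (auto simp: PiE_iff)
  qed
  moreover have "finite (PiE {..<r} (\<lambda>i. {z :: 'k. z powi N i = 1}))"
    using N(1) by (intro finite_PiE finite_powi_eq_one) auto
  ultimately have "finite (L.coord ` stabilizer T \<rho> x)" by (rule finite_subset)
  moreover have "inj_on L.coord (stabilizer T \<rho> x)"
    by (rule inj_on_inverseI[of _ \<theta>]) (simp add: stabilizer_def L.theta_coord)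
  ultimately show ?thesis by (rule finite_imageD)
qed

lemma weight_vectors: "(\<lambda>i. \<iota> (fst i)) ` weight_index sc T \<rho> = L.weight_vec ` R.weights"
proof -
  have "(\<lambda>i. \<iota> (fst i)) ` weight_index sc T \<rho> = \<iota> ` fst ` weight_index sc T \<rho>" by (simp add: image_image)
  also have "\<dots> = L.weight_vec ` R.weights" unfolding R.weight_index_fst by (simp add: image_image L.weight_vec_def)
  finally show ?thesis .
qed

text \<open>
  The sets of weights are exactly the supports of points, which turns the condition on semistable points
  into one on cones and spans of weights.
\<close>

lemma stable_locus:
  "{l \<in> V. \<forall>x\<in>semistable sc T \<rho> \<iota> l. finite (stabilizer T \<rho> x)} =
   {l \<in> V. \<forall>S\<subseteq>L.weight_vec ` R.weights. l \<in> convex_cone hull S \<longrightarrow> span S = V}"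
proof -
  have "(\<forall>x\<in>semistable sc T \<rho> \<iota> l. finite (stabilizer T \<rho> x)) \<longleftrightarrow>
      (\<forall>S\<subseteq>L.weight_vec ` R.weights. l \<in> convex_cone hull S \<longrightarrow> span S = V)" if l: "l \<in> V" for l
  proof
    assume stable: "\<forall>x\<in>semistable sc T \<rho> \<iota> l. finite (stabilizer T \<rho> x)"
    show "\<forall>S\<subseteq>L.weight_vec ` R.weights. l \<in> convex_cone hull S \<longrightarrow> span S = V"
    proof (intro allI impI)
      fix S assume S: "S \<subseteq> L.weight_vec ` R.weights" "l \<in> convex_cone hull S"
      obtain A where A: "A \<subseteq> R.weights" "S = L.weight_vec ` A" using S(1) by (meson subset_imageE)
      obtain x where x: "R.supp x = A" using R.exists_supp_eq[OF A(1)] by blast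
      then have "x \<in> semistable sc T \<rho> \<iota> l" using semistable_iff[OF l] S(2) A(2) by blast
      then show "span S = V" using finite_stabilizer_imp_span[of x] stable x A(2) by blast
    qed
  next
    assume cones: "\<forall>S\<subseteq>L.weight_vec ` R.weights. l \<in> convex_cone hull S \<longrightarrow> span S = V"
    show "\<forall>x\<in>semistable sc T \<rho> \<iota> l. finite (stabilizer T \<rho> x)"
    proof
      fix x assume "x \<in> semistable sc T \<rho> \<iota> l"
      moreover have "L.weight_vec ` R.supp x \<subseteq> L.weight_vec ` R.weights" unfolding R.weights_def by blast
      ultimately show "finite (stabilizer T \<rho> x)"
        using cones semistable_iff[OF l] span_imp_finite_stabilizer by blast
    qed
  qed
  then show ?thesis by blast
qed

text \<open>
  One point with finite stabilizer suffices, as its weights already span.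
\<close>

lemma weights_span:
  assumes "generic_stabilizer_finite sc T \<rho>"
  shows "span (L.weight_vec ` R.weights) = V"
proof -
  obtain x where "finite (stabilizer T \<rho> x)" using assms unfolding generic_stabilizer_finite_def by blast
  then have "V = span (L.weight_vec ` R.supp x)" using finite_stabilizer_imp_span by simp
  also have "\<dots> \<subseteq> span (L.weight_vec ` R.weights)" unfolding R.weights_def by (intro span_mono) blast
  finally have "V \<subseteq> span (L.weight_vec ` R.weights)" .
  moreover have "span (L.weight_vec ` R.weights) \<subseteq> V"
    using L.weight_vec_in_V R.weights_exponents by (intro span_minimal L.subspace_V) auto
  ultimately show ?thesis by blast
qed

theorem stable_locus_eq_complement:
  assumes "quasi_symmetric sc T \<rho> V \<iota>" and "generic_stabilizer_finite sc T \<rho>"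
  shows "{l \<in> V. \<forall>x\<in>semistable sc T \<rho> \<iota> l. finite (stabilizer T \<rho> x)} =
    V - \<Union> (facet_arrangement (Sigma_bar sc T \<rho> \<iota>))"
proof -
  let ?b = "\<lambda>i. \<iota> (fst i)" and ?I = "weight_index sc T \<rho>"
  have V: "span (?b ` ?I) = V" unfolding weight_vectors by (rule weights_span[OF assms(2)])
  have "{l \<in> span (?b ` ?I). \<forall>S\<subseteq>?b ` ?I. l \<in> convex_cone hull S \<longrightarrow> span S = span (?b ` ?I)} =
    span (?b ` ?I) - \<Union> (facet_arrangement (zonotope ?I ?b))"
  proof (rule stable_locus_eq_arrangement_complement[OF R.finite_weight_index])
    fix W assume "subspace W" "W \<subseteq> span (?b ` ?I)" "dim W = 1"
    then show "(\<Sum>i\<in>{i \<in> ?I. ?b i \<in> W}. ?b i) = 0"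
      using assms(1) unfolding quasi_symmetric_def V by blast
  qed
  then show ?thesis
    unfolding stable_locus Sigma_bar_def zonotope_def weight_vectors weights_span[OF assms(2)] .
qed

end

lemma linear_rep_subgroup:
  assumes "linear_rep sc G \<rho>" "T \<subseteq> G" shows "linear_rep sc T \<rho>"
  using assms unfolding linear_rep_def regular_on_def by (meson subset_iff)

theorem corollary2p3:
  fixes sc :: "'k::field_char_0 \<Rightarrow> 'x::ab_group_add \<Rightarrow> 'x"
    and B :: "'x set"
    and G T :: "('k^'m^'m) set"
    and \<rho> :: "'k^'m^'m \<Rightarrow> 'x \<Rightarrow> 'x"
    and V :: "'v::euclidean_space set"
    and \<iota> :: "('k^'m^'m \<Rightarrow> 'k) \<Rightarrow> 'v"
  assumes "split_reductive G T"
    and "finite_dimensional_vector_space sc B"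
    and "linear_rep sc G \<rho>"
    and "real_extension T V \<iota>"
    and "quasi_symmetric sc T \<rho> V \<iota>"
    and "generic_stabilizer_finite sc T \<rho>"
  shows "git_chambers sc T \<rho> V \<iota> =
    components (V - \<Union> (facet_arrangement (Sigma_bar sc T \<rho> \<iota>)))"
proof -
  have T: "T \<subseteq> G" "split_torus T"
    using assms(1) unfolding split_reductive_def maximal_torus_def by auto
  obtain r \<theta> where "split_torus_chart T r \<theta>"
    using split_torus_chart_exists[OF T(2)] by blast
  then interpret git_setting T r \<theta> V \<iota> sc B \<rho>
    using assms(2,4) linear_rep_subgroup[OF assms(3) T(1)]
    by (intro git_setting.intro weight_lattice.intro torus_representation.intro
        weight_lattice_axioms.intro torus_representation_axioms.intro)
  show ?thesis
    unfolding git_chambers_def stable_locus_eq_complement[OF assms(5,6)] ..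
qed

end
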